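(* Let $p \geq 3$ be a prime, let $n \geq 1$ be an integer, and let $G \cong PGL_2(p^{2^n})$. Then the order complex of the poset $\widehat{\mathcal{L}(G)} = \{H \leqslant G \mid 1_G < H < G\}$ of nontrivial proper subgroups of $G$, ordered by inclusion, is contractible.
   Context: For a finite group $G$, $\mathcal{L}(G)$ denotes the lattice of all subgroups of $G$ ordered by inclusion, and $\widehat{\mathcal{L}(G)} := \mathcal{L}(G) \setminus \{1_G, G\}$. The order complex of a poset $P$ is the simplicial complex whose vertices are the elements of $P$ and whose simplices are the finite chains in $P$; topological statements about a poset refer to its order complex. *)

theory Defs
  imports "HOL-Analysis.Analysis" "HOL-Algebra.Coset"
begin

text \<open>2x2 matrices over a field, written (a,b,c,d) for the matrix [[a,b],[c,d]].\<close>
type_synonym 'f mat2 = "'f \<times> 'f \<times> 'f \<times> 'f"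

definition mat2_mult :: "'f::field mat2 \<Rightarrow> 'f mat2 \<Rightarrow> 'f mat2" where
  "mat2_mult A B = (case A of (a,b,c,d) \<Rightarrow> case B of (e,f,g,h) \<Rightarrow>
      (a*e + b*g, a*f + b*h, c*e + d*g, c*f + d*h))"

definition mat2_det :: "'f::field mat2 \<Rightarrow> 'f" where
  "mat2_det A = (case A of (a,b,c,d) \<Rightarrow> a*d - b*c)"

definition GL2 :: "('f::field mat2) monoid" where
  "GL2 = \<lparr>carrier = {A. mat2_det A \<noteq> 0}, mult = mat2_mult, one = (1,0,0,1)\<rparr>"

definition scalars2 :: "('f::field mat2) set" where
  "scalars2 = {(a,0,0,a) | a. a \<noteq> 0}"

definition PGL2 :: "('f::field mat2 set) monoid" where
  "PGL2 = GL2 Mod scalars2"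

definition proper_nontrivial_subgroups :: "('g, 'z) monoid_scheme \<Rightarrow> 'g set set" where
  "proper_nontrivial_subgroups G =
     {H. subgroup H G \<and> H \<noteq> {\<one>\<^bsub>G\<^esub>} \<and> H \<noteq> carrier G}"

text \<open>Geometric realization of the order complex of a poset (P, le): points are
  finitely supported nonnegative weight functions on P with total weight 1 whose
  support is a chain (i.e. a simplex of the order complex).\<close>
definition order_complex_realization :: "'a set \<Rightarrow> ('a \<Rightarrow> 'a \<Rightarrow> bool) \<Rightarrow> ('a \<Rightarrow> real) set" where
  "order_complex_realization P leq =
     {f. (\<forall>x. 0 \<le> f x) \<and> (\<forall>x. x \<notin> P \<longrightarrow> f x = 0) \<and> finite {x. f x \<noteq> 0}
         \<and> (\<forall>x y. f x \<noteq> 0 \<and> f y \<noteq> 0 \<longrightarrow> leq x y \<or> leq y x)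
         \<and> sum f {x. f x \<noteq> 0} = 1}"

text \<open>Its topology (for a finite poset this is the standard simplicial topology):
  subspace of the product topology on functions.\<close>
definition order_complex_topology :: "'a set \<Rightarrow> ('a \<Rightarrow> 'a \<Rightarrow> bool) \<Rightarrow> ('a \<Rightarrow> real) topology" where
  "order_complex_topology P leq = subtopology (powertop_real UNIV) (order_complex_realization P leq)"

end

theory Submission
  imports Defs
begin

text \<open>
  Write \<open>q = p^(2^n)\<close>, so that \<open>q\<close> is 1 modulo 8, let \<open>S = PSL\<^sub>2(q)\<close>, of index 2 in \<open>G\<close>, and
  let \<open>C(x)\<close> denote centralizers in \<open>G\<close>. The subgroups \<open>H\<close> with \<open>H \<inter> S \<noteq> 1\<close> form a contractible
  poset because \<open>H \<ge> H \<inter> S \<le> S\<close>. The remaining vertices are \<open>\<langle>t\<rangle>\<close> with \<open>t\<close> an involution outside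
  \<open>S\<close>, and they may be added if every interval \<open>(\<langle>t\<rangle>, G)\<close> is contractible. In this interval the
  subgroups \<open>H\<close> with \<open>H \<inter> C(t) \<noteq> \<langle>t\<rangle>\<close> are again contracted by \<open>H \<ge> H \<inter> C(t) \<le> C(t)\<close>. If
  \<open>H \<inter> C(t) = \<langle>t\<rangle>\<close>, then \<open>t\<close> acts on \<open>A = H \<inter> S\<close> without fixed points, hence inverts it, and \<open>A\<close>
  lies in a torus with a unique involution \<open>z\<close>, which centralizes \<open>H\<close>; the link \<open>(H, G)\<close> is
  contracted by \<open>K \<ge> K \<inter> C(z) \<le> C(z)\<close>. This needs \<open>K \<inter> C(z) > H\<close> for all \<open>K > H\<close>. If it failed for
  some \<open>K\<close>, then \<open>A\<close> would be a trivial intersection subgroup of \<open>K\<close> with normalizer of order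
  \<open>2 |A|\<close>, so that its conjugates would fill at least two thirds of \<open>K \<inter> S\<close>; the conjugates of a
  second torus, through \<open>t\<close> or through an involution of \<open>S\<close> commuting with \<open>t\<close>, leave no room for
  that. Since 2 and -1 are squares, elements of order 4 lie in \<open>S\<close>, which excludes the configuration
  of the symmetric group on 4 points, and \<open>t\<close> fixes no point of the projective line. Thus no
  classification of the subgroups of \<open>G\<close> is needed.
\<close>

section \<open>Contractible order complexes\<close>

text \<open>The order complex is placed in a finite-dimensional Euclidean space, one coordinate for
  each element of the finite type, so that the theory of Euclidean retracts applies.\<close>

definition chain_complex :: "'b::{finite,order} set \<Rightarrow> (real, 'b) vec set" where
  "chain_complex P = {x. (\<forall>i. 0 \<le> x $ i) \<and> (\<forall>i. i \<notin> P \<longrightarrow> x $ i = 0)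
     \<and> (\<forall>i j. x $ i \<noteq> 0 \<and> x $ j \<noteq> 0 \<longrightarrow> i \<le> j \<or> j \<le> i) \<and> (\<Sum>i\<in>UNIV. x $ i) = 1}"

definition face :: "'b::finite set \<Rightarrow> (real, 'b) vec set" where
  "face c = {x. (\<forall>i. 0 \<le> x $ i) \<and> (\<forall>i. i \<notin> c \<longrightarrow> x $ i = 0) \<and> (\<Sum>i\<in>UNIV. x $ i) = 1}"

lemma closed_face: "closed (face c)"
proof -
  have "face c = (\<Inter>i. {x. 0 \<le> x $ i}) \<inter> (\<Inter>i\<in>-c. {x. x $ i = 0}) \<inter> {x. (\<Sum>i\<in>UNIV. x $ i) = 1}"
    unfolding face_def by auto
  moreover have "closed (\<Inter>i. {x::(real,'a) vec. 0 \<le> x $ i})"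
    by (intro closed_INT ballI closed_Collect_le continuous_intros)
  moreover have "closed (\<Inter>i\<in>-c. {x::(real,'a) vec. x $ i = 0})"
    by (intro closed_INT ballI closed_Collect_eq continuous_intros)
  moreover have "closed {x::(real,'a) vec. (\<Sum>i\<in>UNIV. x $ i) = 1}"
    by (intro closed_Collect_eq continuous_intros)
  ultimately show ?thesis by (metis closed_Int)
qed

lemma convex_face: "convex (face c)"
  unfolding convex_alt face_def
  by (auto simp: sum.distrib simp flip: sum_distrib_left)

lemma chain_complex_eq_Union_face:
  "chain_complex P = \<Union>(face ` {c. c \<subseteq> P \<and> (\<forall>i\<in>c. \<forall>j\<in>c. i \<le> j \<or> j \<le> i)})"
proof (intro equalityI subsetI)
  fix x assume x: "x \<in> chain_complex P"
  let ?c = "{i. x $ i \<noteq> 0}"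
  have "x \<in> face ?c" using x by (auto simp: chain_complex_def face_def)
  moreover have "?c \<subseteq> P" "\<forall>i\<in>?c. \<forall>j\<in>?c. i \<le> j \<or> j \<le> i"
    using x by (auto simp: chain_complex_def)
  ultimately show "x \<in> \<Union>(face ` {c. c \<subseteq> P \<and> (\<forall>i\<in>c. \<forall>j\<in>c. i \<le> j \<or> j \<le> i)})"
    by blast
next
  fix x assume "x \<in> \<Union>(face ` {c. c \<subseteq> P \<and> (\<forall>i\<in>c. \<forall>j\<in>c. i \<le> j \<or> j \<le> i)})"
  then obtain c where "x \<in> face c" "c \<subseteq> P" "\<forall>i\<in>c. \<forall>j\<in>c. i \<le> j \<or> j \<le> i"
    by blast
  then show "x \<in> chain_complex P"
    unfolding face_def chain_complex_def by blast
qed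

lemma closed_chain_complex: "closed (chain_complex P)"
  unfolding chain_complex_eq_Union_face by (intro closed_UN) (auto simp: closed_face)

text \<open>For an ANR, being an AR amounts to being nonempty and contractible. \<open>AR\<close> is
  the working notion below because it passes to unions of two closed ARs that meet in an AR.\<close>

lemma ANR_chain_complex: "ANR (chain_complex P)"
  unfolding chain_complex_eq_Union_face
  by (rule ANR_finite_Union_convex_closed) (auto simp: closed_face convex_face)

definition link :: "'b::order \<Rightarrow> 'b set \<Rightarrow> 'b set" where
  "link x P = {y \<in> P. y < x \<or> x < y}"

text \<open>Every chain remains a chain after adjoining \<open>v\<close>, so the complex is a cone,
  starlike with respect to the vertex \<open>axis v 1\<close>.\<close>

lemma AR_chain_complex_cone:
  assumes "v \<in> P" and cmp: "\<And>y. y \<in> P \<Longrightarrow> y \<le> v \<or> v \<le> y"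
  shows "AR (chain_complex P)"
proof -
  let ?e = "axis v 1 :: (real, 'a) vec"
  have e: "?e \<in> chain_complex P"
    using assms(1) by (auto simp: chain_complex_def axis_def)
  have "starlike (chain_complex P)"
    unfolding starlike_def
  proof (intro bexI[of _ ?e] ballI subsetI e)
    fix x y assume x: "x \<in> chain_complex P" and "y \<in> closed_segment ?e x"
    then obtain u where u: "0 \<le> u" "u \<le> 1" and y: "y = (1 - u) *\<^sub>R ?e + u *\<^sub>R x"
      by (auto simp: in_segment)
    have supp: "i = v \<or> x $ i \<noteq> 0" if "y $ i \<noteq> 0" for i
      using that by (auto simp: y axis_def)
    have inP: "i \<in> P" if "x $ i \<noteq> 0" for i
      using x that by (auto simp: chain_complex_def)
    have "y \<in> chain_complex P"
      unfolding chain_complex_def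
    proof (intro CollectI conjI allI impI)
      show "0 \<le> y $ i" for i
        using x u by (auto simp: y axis_def chain_complex_def)
      show "y $ i = 0" if "i \<notin> P" for i
        using supp inP assms(1) that by blast
      show "i \<le> j \<or> j \<le> i" if "y $ i \<noteq> 0 \<and> y $ j \<noteq> 0" for i j
        using that supp[of i] supp[of j] inP cmp x unfolding chain_complex_def by blast
      show "(\<Sum>i\<in>UNIV. y $ i) = 1"
        using x by (simp add: y sum.distrib axis_def chain_complex_def flip: sum_distrib_left)
    qed
    then show "y \<in> chain_complex P" .
  qed
  then show ?thesis
    using AR_ANR ANR_chain_complex starlike_imp_contractible e by blast
qed

text \<open>Simplices avoiding \<open>v\<close> form \<open>?A\<close>; those containing
  \<open>v\<close> lie in \<open>?B\<close>, the cone over the link. Both sets are closed and they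
  meet in the complex of the link.\<close>

lemma AR_chain_complex_glue:
  assumes "v \<in> P" "AR (chain_complex (P - {v}))" "AR (chain_complex (link v P))"
  shows "AR (chain_complex P)"
proof -
  let ?A = "chain_complex (P - {v})" and ?B = "chain_complex (insert v (link v P))"
  have "chain_complex P = ?A \<union> ?B"
  proof (intro equalityI subsetI)
    fix x assume x: "x \<in> chain_complex P"
    show "x \<in> ?A \<union> ?B"
    proof (cases "x $ v = 0")
      case True
      then have "x \<in> ?A" using x by (auto simp: chain_complex_def)
      then show ?thesis ..
    next
      case False
      have "i \<in> insert v (link v P)" if "x $ i \<noteq> 0" for i
        using x that False unfolding chain_complex_def link_def by force
      then have "x \<in> ?B" using x unfolding chain_complex_def by blast
      then show ?thesis ..
    qed
  next
    fix x assume "x \<in> ?A \<union> ?B"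
    then show "x \<in> chain_complex P"
      using assms(1) unfolding chain_complex_def link_def by auto
  qed
  moreover have "?A \<inter> ?B = chain_complex (link v P)"
    unfolding chain_complex_def link_def by auto
  moreover have "AR ?B"
    by (rule AR_chain_complex_cone[of v]) (auto simp: link_def)
  ultimately show ?thesis
    using AR_closed_Un[of ?A ?B] assms closed_chain_complex by metis
qed

text \<open>Combinatorial form of the contraction through \<open>inf x c\<close>. A maximal
  \<open>x\<close> among the elements not below \<open>c\<close> has nothing above it in
  \<open>P\<close>, so its link is the part of \<open>P\<close> below \<open>x\<close>, which
  satisfies the hypotheses with center \<open>inf x c\<close>. Deleting \<open>x\<close> preserves
  them too, because meets with \<open>c\<close> lie below \<open>c\<close>.\<close>

lemma AR_chain_complex_meet:
  fixes P :: "'b::{finite,semilattice_inf} set"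
  assumes "c \<in> P" "\<And>x. x \<in> P \<Longrightarrow> inf x c \<in> P"
  shows "AR (chain_complex P)"
  using assms
proof (induction "card P" arbitrary: P c rule: less_induct)
  case less
  show ?case
  proof (cases "\<forall>x\<in>P. x \<le> c")
    case True
    then show ?thesis using AR_chain_complex_cone[OF less.prems(1)] by blast
  next
    case False
    let ?N = "{x\<in>P. \<not> x \<le> c}"
    obtain x where x: "x \<in> ?N" and max: "\<And>y. y \<in> ?N \<Longrightarrow> x \<le> y \<Longrightarrow> x = y"
      using finite_has_maximal[of ?N] False by auto
    have max': "y = x" if "y \<in> P" "x \<le> y" for y
      using max[of y] that x order_trans[of x y c] by auto
    then have link: "link x P = {y\<in>P. y < x}"
      unfolding link_def by force
    have "card (P - {x}) < card P"
      using x by (intro psubset_card_mono) auto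
    then have 1: "AR (chain_complex (P - {x}))"
    proof (rule less.hyps)
      show "c \<in> P - {x}"
        using less.prems(1) x by auto
      show "inf y c \<in> P - {x}" if "y \<in> P - {x}" for y
        using less.prems(2)[of y] that x inf_le2[of y c] by fastforce
    qed
    have "card (link x P) < card P"
      using x by (intro psubset_card_mono) (auto simp: link_def)
    moreover have m: "inf x c \<in> link x P"
      using x less.prems by (auto simp: link less_le_not_le)
    moreover have "inf y (inf x c) \<in> link x P" if "y \<in> link x P" for y
    proof -
      have "inf y (inf x c) = inf y c"
        using that by (simp add: link inf.absorb1 less_imp_le flip: inf.assoc)
      moreover have "inf y c \<in> P" "inf y c < x"
        using that less.prems le_less_trans[of "inf y c" y x] by (auto simp: link)
      ultimately show ?thesis by (simp add: link)
    qed
    ultimately have 2: "AR (chain_complex (link x P))"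
      by (rule less.hyps)
    show ?thesis using AR_chain_complex_glue[OF _ 1 2] x by auto
  qed
qed

text \<open>The elements of \<open>P - Q\<close> are peeled off one at a time, each time a minimal
  one. As \<open>Q\<close> is upward closed, nothing of \<open>P\<close> lies below such an
  \<open>x\<close>; its link is therefore the part above it, and deleting it does not change the
  part above any other remaining element.\<close>

lemma AR_chain_complex_upset:
  fixes P :: "'b::{finite,order} set"
  assumes "Q \<subseteq> P" and up: "\<And>x y. x \<in> Q \<Longrightarrow> y \<in> P \<Longrightarrow> x \<le> y \<Longrightarrow> y \<in> Q"
    and "AR (chain_complex Q)"
    and "\<And>x. x \<in> P - Q \<Longrightarrow> AR (chain_complex {y\<in>P. x < y})"
  shows "AR (chain_complex P)"
  using assms
proof (induction "card P" arbitrary: P rule: less_induct)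
  case less
  show ?case
  proof (cases "P = Q")
    case True
    then show ?thesis using less.prems by simp
  next
    case False
    then have "P - Q \<noteq> {}" using less.prems(1) by blast
    then obtain x where x: "x \<in> P - Q" and min: "\<And>y. y \<in> P - Q \<Longrightarrow> y \<le> x \<Longrightarrow> x = y"
      using finite_has_minimal[of "P - Q"] by auto
    have min': "\<not> y < x" if "y \<in> P" for y
      using min[of y] that x less.prems(2)[of y x] by (cases "y \<in> Q") (auto simp: less_le)
    then have link: "link x P = {y\<in>P. x < y}"
      unfolding link_def by auto
    have "card (P - {x}) < card P"
      using x by (intro psubset_card_mono) auto
    then have 1: "AR (chain_complex (P - {x}))"
    proof (rule less.hyps)
      show "AR (chain_complex {y \<in> P - {x}. x' < y})" if "x' \<in> P - {x} - Q" for x'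
      proof -
        have "{y \<in> P - {x}. x' < y} = {y \<in> P. x' < y}"
          using min'[of x'] that by auto
        then show ?thesis using less.prems(4)[of x'] that by auto
      qed
    qed (use less.prems x in auto)
    show ?thesis
      using AR_chain_complex_glue[OF _ 1] x less.prems(4)[OF x] by (simp add: link)
  qed
qed

section \<open>Comparison with the geometric realization in the product topology\<close>

lemma order_complex_topology_homeomorphic:
  fixes P :: "'b::{finite,order} set" and P' :: "'c set"
  assumes bij: "bij_betw h P P'"
    and mono: "\<And>x y. x \<in> P \<Longrightarrow> y \<in> P \<Longrightarrow> leq (h x) (h y) \<longleftrightarrow> x \<le> y"
  shows "top_of_set (chain_complex P) homeomorphic_space order_complex_topology P' leq"
proof -
  define k where "k = inv_into P h"
  have hk: "h (k y) = y" "k y \<in> P" if "y \<in> P'" for y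
    using bij that unfolding k_def by (auto simp: bij_betw_inv_into_right bij_betw_def inv_into_into)
  have kh: "k (h x) = x" "h x \<in> P'" if "x \<in> P" for x
    using bij that unfolding k_def by (auto simp: bij_betw_inv_into_left bij_betw_def)
  define f where "f = (\<lambda>(x::(real,'b) vec) y. if y \<in> P' then x $ k y else 0)"
  define g where "g = (\<lambda>(w::'c \<Rightarrow> real). \<chi> i. if i \<in> P then w (h i) else 0)"
  have finP': "finite P'" using bij_betw_finite[OF bij] by simp
  have sumf: "sum (f x) {y. f x y \<noteq> 0} = (\<Sum>i\<in>UNIV. x $ i)" if "\<forall>i. i \<notin> P \<longrightarrow> x $ i = 0" for x
  proof -
    have "sum (f x) {y. f x y \<noteq> 0} = sum (f x) P'"
      by (rule sum.mono_neutral_left) (auto simp: f_def finP')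
    also have "\<dots> = (\<Sum>i\<in>P. f x (h i))"
      by (rule sum.reindex_bij_betw[symmetric]) (rule bij)
    also have "\<dots> = (\<Sum>i\<in>P. x $ i)"
      by (rule sum.cong) (auto simp: f_def kh)
    also have "\<dots> = (\<Sum>i\<in>UNIV. x $ i)"
      by (rule sum.mono_neutral_left) (auto simp: that)
    finally show ?thesis .
  qed
  have f_in: "f x \<in> order_complex_realization P' leq" if x: "x \<in> chain_complex P" for x
    unfolding order_complex_realization_def
  proof (intro CollectI conjI allI impI)
    show "finite {y. f x y \<noteq> 0}"
      by (rule finite_subset[OF _ finP']) (auto simp: f_def)
    show "leq a b \<or> leq b a" if "f x a \<noteq> 0 \<and> f x b \<noteq> 0" for a b
      using that x hk[of a] hk[of b] mono[of "k a" "k b"] mono[of "k b" "k a"]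
      by (auto simp: f_def chain_complex_def split: if_splits)
    show "sum (f x) {y. f x y \<noteq> 0} = 1"
      using x sumf[of x] by (auto simp: chain_complex_def)
  qed (use x in \<open>auto simp: f_def chain_complex_def\<close>)
  have gf: "g (f x) = x" if "x \<in> chain_complex P" for x
    using that by (auto simp: vec_eq_iff g_def f_def kh chain_complex_def)
  have fg: "f (g w) = w" if "w \<in> order_complex_realization P' leq" for w
    using that by (auto simp: fun_eq_iff g_def f_def hk order_complex_realization_def)
  have g_in: "g w \<in> chain_complex P" if w: "w \<in> order_complex_realization P' leq" for w
    unfolding chain_complex_def
  proof (intro CollectI conjI allI impI)
    show "0 \<le> g w $ i" for i
      using w by (auto simp: g_def order_complex_realization_def)
    show "i \<le> j \<or> j \<le> i" if "g w $ i \<noteq> 0 \<and> g w $ j \<noteq> 0" for i j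
      using that w mono[of i j] mono[of j i]
      by (auto simp: g_def order_complex_realization_def split: if_splits)
    have "(\<Sum>i\<in>UNIV. g w $ i) = sum (f (g w)) {y. f (g w) y \<noteq> 0}"
      by (rule sumf[symmetric]) (auto simp: g_def)
    then show "(\<Sum>i\<in>UNIV. g w $ i) = 1"
      using w by (simp add: fg) (simp add: order_complex_realization_def)
  qed (auto simp: g_def)
  have "continuous_map (top_of_set (chain_complex P)) (order_complex_topology P' leq) f"
    unfolding order_complex_topology_def continuous_map_in_subtopology continuous_map_componentwise_UNIV
  proof (intro conjI allI)
    show "continuous_map (top_of_set (chain_complex P)) euclideanreal (\<lambda>x. f x y)" for y
      by (cases "y \<in> P'") (auto simp: f_def intro!: continuous_intros)
  qed (use f_in in auto)
  moreover have "continuous_map (order_complex_topology P' leq) (top_of_set (chain_complex P)) g"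
    unfolding order_complex_topology_def continuous_map_in_subtopology
  proof (intro conjI)
    have comp: "continuous_map (subtopology (powertop_real UNIV) (order_complex_realization P' leq))
            euclideanreal (\<lambda>w. g w $ i)" for i
      by (cases "i \<in> P")
         (auto simp: g_def intro!: continuous_map_from_subtopology continuous_map_product_projection)
    \<comment> \<open>Continuity into the vector space follows from continuity of the coordinates,
      by expanding \<open>g w\<close> in the standard basis.\<close>
    have "continuous_map (subtopology (powertop_real UNIV) (order_complex_realization P' leq))
            euclidean (\<lambda>w. \<Sum>i\<in>UNIV. (g w $ i) *\<^sub>R axis i (1::real))"
    proof (intro continuous_map_sum)
      show "continuous_map (subtopology (powertop_real UNIV) (order_complex_realization P' leq))
              euclidean (\<lambda>w. (g w $ i) *\<^sub>R axis i (1::real))" for i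
      proof -
        have "continuous_on UNIV (\<lambda>r::real. r *\<^sub>R (axis i 1 :: (real,'b) vec))"
          by (intro continuous_intros)
        then show ?thesis
          using continuous_map_compose[OF comp, of euclidean "\<lambda>r. r *\<^sub>R axis i 1" i]
          by (simp add: o_def)
      qed
    qed auto
    then show "continuous_map (subtopology (powertop_real UNIV) (order_complex_realization P' leq))
            euclidean g"
      by (simp add: basis_expansion flip: scalar_mult_eq_scaleR)
  qed (use g_in in \<open>auto simp: order_complex_realization_def\<close>)
  ultimately show ?thesis
    unfolding homeomorphic_space_def homeomorphic_maps_def
    using gf fg by (intro exI[of _ f] exI[of _ g]) (auto simp: order_complex_topology_def)
qed

section \<open>Groups resembling the projective linear group\<close>

context group
begin

definition conjugate :: "'a \<Rightarrow> 'a \<Rightarrow> 'a" where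
  "conjugate x a = x \<otimes> a \<otimes> inv x"

definition involution :: "'a \<Rightarrow> bool" where
  "involution z \<longleftrightarrow> z \<in> carrier G \<and> z \<noteq> \<one> \<and> z \<otimes> z = \<one>"

definition centralizer :: "'a \<Rightarrow> 'a set" where
  "centralizer a = {x \<in> carrier G. x \<otimes> a = a \<otimes> x}"

lemma conjugate_closed [simp]: "x \<in> carrier G \<Longrightarrow> a \<in> carrier G \<Longrightarrow> conjugate x a \<in> carrier G"
  by (simp add: conjugate_def)

lemma conjugate_mult:
  assumes "x \<in> carrier G" "a \<in> carrier G" "b \<in> carrier G"
  shows "conjugate x (a \<otimes> b) = conjugate x a \<otimes> conjugate x b"
  unfolding conjugate_def using assms by (simp add: m_assoc) (simp add: inv_solve_left m_assoc[symmetric])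

lemma conjugate_conjugate:
  assumes "x \<in> carrier G" "y \<in> carrier G" "a \<in> carrier G"
  shows "conjugate x (conjugate y a) = conjugate (x \<otimes> y) a"
  unfolding conjugate_def using assms by (simp add: m_assoc inv_mult_group)

lemma conjugate_one_left [simp]: "a \<in> carrier G \<Longrightarrow> conjugate \<one> a = a"
  by (simp add: conjugate_def)

lemma conjugate_one [simp]: "x \<in> carrier G \<Longrightarrow> conjugate x \<one> = \<one>"
  by (simp add: conjugate_def)

lemma conjugate_inv_cancel [simp]:
  assumes "x \<in> carrier G" "a \<in> carrier G"
  shows "conjugate (inv x) (conjugate x a) = a" "conjugate x (conjugate (inv x) a) = a"
  using assms by (simp_all add: conjugate_conjugate)

lemma conjugate_eq_iff:
  assumes "x \<in> carrier G" "a \<in> carrier G" "b \<in> carrier G"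
  shows "conjugate x a = conjugate x b \<longleftrightarrow> a = b"
  using assms conjugate_inv_cancel(1) by metis

lemma conjugate_eq_one_iff [simp]:
  "x \<in> carrier G \<Longrightarrow> a \<in> carrier G \<Longrightarrow> conjugate x a = \<one> \<longleftrightarrow> a = \<one>"
  using conjugate_eq_iff[of x a \<one>] by simp

lemma conjugate_inv:
  assumes "x \<in> carrier G" "a \<in> carrier G"
  shows "conjugate x (inv a) = inv (conjugate x a)"
  using assms by (intro inv_equality[symmetric]) (simp_all add: conjugate_mult[symmetric])

lemma conjugate_fixed_iff:
  assumes "x \<in> carrier G" "a \<in> carrier G"
  shows "conjugate x a = a \<longleftrightarrow> x \<otimes> a = a \<otimes> x"
  unfolding conjugate_def using assms by (metis inv_solve_right m_closed)

lemma conjugate_in_subgroup: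
  assumes "subgroup K G" "x \<in> K" "a \<in> K"
  shows "conjugate x a \<in> K"
  unfolding conjugate_def using assms by (simp add: subgroup.m_closed subgroup.m_inv_closed)

lemma conjugate_commute_iff:
  assumes "x \<in> carrier G" "a \<in> carrier G" "b \<in> carrier G"
  shows "conjugate x a \<otimes> conjugate x b = conjugate x b \<otimes> conjugate x a \<longleftrightarrow> a \<otimes> b = b \<otimes> a"
  using assms conjugate_eq_iff[of x "a \<otimes> b" "b \<otimes> a"] by (simp add: conjugate_mult)

lemma conjugate_square_eq_one_iff:
  assumes "x \<in> carrier G" "a \<in> carrier G"
  shows "conjugate x a \<otimes> conjugate x a = \<one> \<longleftrightarrow> a \<otimes> a = \<one>"
  using assms conjugate_eq_one_iff[of x "a \<otimes> a"] by (simp add: conjugate_mult)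

lemma involution_conjugate: "involution z \<Longrightarrow> x \<in> carrier G \<Longrightarrow> involution (conjugate x z)"
  by (auto simp: involution_def conjugate_square_eq_one_iff)

lemma involution_inv: "involution z \<Longrightarrow> inv z = z"
  by (auto simp: involution_def intro: inv_equality)

lemma centralizer_subgroup:
  assumes "a \<in> carrier G"
  shows "subgroup (centralizer a) G"
proof (rule subgroupI)
  show "centralizer a \<noteq> {}" using assms by (auto simp: centralizer_def)
  show "inv x \<in> centralizer a" if "x \<in> centralizer a" for x
    using that assms unfolding centralizer_def mem_Collect_eq
    by (metis conjugate_fixed_iff conjugate_inv_cancel(1) inv_closed)
  show "x \<otimes> y \<in> centralizer a" if "x \<in> centralizer a" "y \<in> centralizer a" for x y
  proof -
    have "conjugate (x \<otimes> y) a = a"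
      using that assms conjugate_conjugate[of x y a] conjugate_fixed_iff[of x a]
        conjugate_fixed_iff[of y a] by (simp add: centralizer_def)
    then show ?thesis using that assms by (simp add: centralizer_def conjugate_fixed_iff)
  qed
qed (auto simp: centralizer_def)

text \<open>The fibres of conjugation on \<open>K \<times> E\<close> are small: if
  \<open>(x, b')\<close> and \<open>(y, b)\<close> have the same image, then
  \<open>inv y \<otimes> x\<close> conjugates \<open>b'\<close> to \<open>b\<close> and lies in
  \<open>N\<close>, while \<open>x\<close> determines \<open>b'\<close>. Each fibre thus has at most
  \<open>card N\<close> elements.\<close>

lemma card_conjugates_ge:
  assumes "finite (carrier G)" "subgroup K G" "E \<subseteq> K" "N \<subseteq> K"
    and stab: "\<And>x b. x \<in> K \<Longrightarrow> b \<in> E \<Longrightarrow> conjugate x b \<in> E \<Longrightarrow> x \<in> N"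
  shows "card K * card E \<le> card (case_prod conjugate ` (K \<times> E)) * card N"
proof -
  let ?f = "case_prod conjugate"
  have Kc: "K \<subseteq> carrier G" using assms subgroup.subset by blast
  then have fin: "finite K" "finite E" "finite N"
    using assms by (meson finite_subset)+
  have fib: "card {p \<in> K \<times> E. ?f p = c} \<le> card N" if c: "c \<in> ?f ` (K \<times> E)" for c
  proof -
    obtain y b where y: "y \<in> K" "b \<in> E" "c = conjugate y b"
      using c by auto
    have "(\<lambda>p. inv y \<otimes> fst p) ` {p \<in> K \<times> E. ?f p = c} \<subseteq> N"
    proof (rule image_subsetI)
      fix p assume "p \<in> {p \<in> K \<times> E. ?f p = c}"
      then obtain x b' where p: "p = (x, b')" and x: "x \<in> K" "b' \<in> E" "conjugate x b' = c"
        by auto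
      then have "conjugate (inv y \<otimes> x) b' = b"
        using y Kc assms(3) by (subst conjugate_conjugate[symmetric]) (auto simp: subset_iff)
      then show "inv y \<otimes> fst p \<in> N"
        using stab[of "inv y \<otimes> x" b'] p x y assms(2)
        by (auto simp: subgroup.m_closed subgroup.m_inv_closed)
    qed
    moreover have "inj_on (\<lambda>p. inv y \<otimes> fst p) {p \<in> K \<times> E. ?f p = c}"
    proof (rule inj_onI, clarsimp)
      fix x b1 x' b2
      assume *: "x \<in> K" "x' \<in> K" "b1 \<in> E" "b2 \<in> E" "c = conjugate x b1" "conjugate x' b2 = conjugate x b1"
        "inv y \<otimes> x = inv y \<otimes> x'"
      then have "x = x'" using Kc y by (metis Units_eq Units_l_cancel inv_closed subsetD)
      then show "x = x' \<and> b1 = b2"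
        using * Kc assms(3) conjugate_eq_iff[of x b1 b2] by auto
    qed
    ultimately show ?thesis using fin card_inj_on_le by blast
  qed
  have "card K * card E = (\<Sum>p\<in>K \<times> E. 1)"
    by (simp add: card_cartesian_product)
  also have "\<dots> = (\<Sum>c\<in>?f ` (K \<times> E). \<Sum>p\<in>{p \<in> K \<times> E. ?f p = c}. 1)"
    by (rule sum.image_gen) (use fin in auto)
  also have "\<dots> = (\<Sum>c\<in>?f ` (K \<times> E). card {p \<in> K \<times> E. ?f p = c})"
    by simp
  also have "\<dots> \<le> (\<Sum>c\<in>?f ` (K \<times> E). card N)"
    by (intro sum_mono fib)
  finally show ?thesis by simp
qed

end

text \<open>The facts about the projective linear group on which the subgroup argument rests, with
  \<open>S\<close> in the role of PSL_2. \<open>commuting_involution_unique\<close> attaches to an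
  element of nontrivial square at most one involution, that of its torus.
  \<open>involution_rank\<close> bounds elementary abelian 2-subgroups by order 4.\<close>

locale pgl2_like = group G for G (structure) +
  fixes S
  assumes finite_carrier: "finite (carrier G)"
    and S: "subgroup S G" "S \<noteq> {\<one>}" "S \<noteq> carrier G"
    and index2: "x \<in> carrier G - S \<Longrightarrow> y \<in> carrier G - S \<Longrightarrow> x \<otimes> y \<in> S"
    and ex_commuting_involution:
      "involution t \<Longrightarrow> t \<notin> S \<Longrightarrow> a \<in> carrier G \<Longrightarrow> a \<otimes> a \<noteq> \<one> \<Longrightarrow> conjugate t a = inv a
        \<Longrightarrow> \<exists>z. involution z \<and> z \<otimes> a = a \<otimes> z"
    and commuting_involution_unique:
      "a \<in> carrier G \<Longrightarrow> a \<otimes> a \<noteq> \<one> \<Longrightarrow> involution z \<Longrightarrow> involution z' \<Longrightarrow> z \<otimes> a = a \<otimes> z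
        \<Longrightarrow> z' \<otimes> a = a \<otimes> z' \<Longrightarrow> z = z'"
    and involution_not_central: "involution z \<Longrightarrow> centralizer z \<noteq> carrier G"
    and involution_rank: "involution x \<Longrightarrow> involution y \<Longrightarrow> involution z \<Longrightarrow> x \<otimes> y = y \<otimes> x
        \<Longrightarrow> x \<otimes> z = z \<otimes> x \<Longrightarrow> y \<otimes> z = z \<otimes> y \<Longrightarrow> x \<noteq> y \<Longrightarrow> x \<noteq> z \<Longrightarrow> y \<noteq> z \<Longrightarrow> x \<otimes> y = z"
    and order_four: "r \<in> carrier G \<Longrightarrow> r \<otimes> r \<noteq> \<one> \<Longrightarrow> (r \<otimes> r) \<otimes> (r \<otimes> r) = \<one> \<Longrightarrow> r \<in> S"
    and centralizer_outer: "involution t \<Longrightarrow> t \<notin> S \<Longrightarrow> centralizer t \<noteq> {\<one>, t}"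
begin

lemma S_subset: "S \<subseteq> carrier G"
  using S(1) subgroup.subset by blast

lemma mult_in_S_iff:
  assumes "x \<in> carrier G" "y \<in> carrier G"
  shows "x \<otimes> y \<in> S \<longleftrightarrow> (x \<in> S \<longleftrightarrow> y \<in> S)"
proof -
  have "y \<in> S" if "x \<in> S" "x \<otimes> y \<in> S"
  proof -
    have "inv x \<otimes> (x \<otimes> y) \<in> S"
      using that S(1) by (meson subgroup.m_closed subgroup.m_inv_closed)
    then show ?thesis using assms by (simp add: m_assoc[symmetric])
  qed
  moreover have "x \<in> S" if "y \<in> S" "x \<otimes> y \<in> S"
  proof -
    have "(x \<otimes> y) \<otimes> inv y \<in> S"
      using that S(1) by (meson subgroup.m_closed subgroup.m_inv_closed)
    then show ?thesis using assms by (simp add: m_assoc)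
  qed
  ultimately show ?thesis
    using index2[of x y] assms subgroup.m_closed[OF S(1), of x y] by blast
qed

lemma inv_in_S_iff: "x \<in> carrier G \<Longrightarrow> inv x \<in> S \<longleftrightarrow> x \<in> S"
  using mult_in_S_iff[of x "inv x"] S(1) subgroup.one_closed by auto

lemma conjugate_in_S_iff:
  "x \<in> carrier G \<Longrightarrow> a \<in> carrier G \<Longrightarrow> conjugate x a \<in> S \<longleftrightarrow> a \<in> S"
  unfolding conjugate_def by (auto simp: mult_in_S_iff inv_in_S_iff)

lemma one_in_S [simp]: "\<one> \<in> S"
  using S(1) subgroup.one_closed by auto

lemma card_subgroup_outer:
  assumes K: "subgroup K G" and t: "t \<in> K" "t \<notin> S"
  shows "card K = 2 * card (K \<inter> S)"
proof -
  have Kc: "K \<subseteq> carrier G" using K subgroup.subset by blast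
  have fin: "finite K" using Kc finite_carrier finite_subset by blast
  have inj: "inj_on (\<lambda>x. t \<otimes> x) X" if "X \<subseteq> K" for X
    using that t Kc by (intro inj_onI) (metis Units_eq Units_l_cancel subsetD)
  have "(\<lambda>x. t \<otimes> x) ` (K \<inter> S) \<subseteq> K - S" "(\<lambda>x. t \<otimes> x) ` (K - S) \<subseteq> K \<inter> S"
    using t Kc subgroup.m_closed[OF K t(1)] mult_in_S_iff[of t] by (auto simp: subset_iff)
  then have "card (K \<inter> S) = card (K - S)"
    using fin inj card_inj_on_le[of "\<lambda>x. t \<otimes> x" "K \<inter> S" "K - S"]
      card_inj_on_le[of "\<lambda>x. t \<otimes> x" "K - S" "K \<inter> S"] by (simp add: le_antisym)
  moreover have "card K = card (K \<inter> S) + card (K - S)"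
    using fin by (metis card_Int_Diff)
  ultimately show ?thesis by simp
qed

end

section \<open>Subgroups in which an outer involution has the smallest possible centralizer\<close>

locale outer_involution = pgl2_like +
  fixes t
  assumes t: "involution t" "t \<notin> S"
begin

lemma t_carrier [simp]: "t \<in> carrier G"
  using t(1) by (simp add: involution_def)

text \<open>Apart from \<open>{\<one>, t}\<close>, these are the subgroups above \<open>t\<close>
  that the contraction through \<open>centralizer t\<close> does not reach.\<close>

definition self_centralizing :: "'a set \<Rightarrow> bool" where
  "self_centralizing H \<longleftrightarrow> subgroup H G \<and> H \<inter> centralizer t = {\<one>, t}"

lemma conjugate_t_conjugate_t: "a \<in> carrier G \<Longrightarrow> conjugate t (conjugate t a) = a"
  using conjugate_inv_cancel(1)[of t a] by (simp add: involution_inv[OF t(1)])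

context
  fixes H assumes H: "self_centralizing H"
begin

lemma subgroup_H: "subgroup H G" and t_in_H: "t \<in> H"
  using H by (auto simp: self_centralizing_def)

lemma H_carrier: "x \<in> H \<Longrightarrow> x \<in> carrier G"
  by (rule subgroup.mem_carrier[OF subgroup_H])

lemma fixed_eq_one: "c \<in> H \<Longrightarrow> c \<in> S \<Longrightarrow> conjugate t c = c \<Longrightarrow> c = \<one>"
  using H t(2) H_carrier[of c] conjugate_fixed_iff[of t c]
  unfolding self_centralizing_def centralizer_def by force

text \<open>\<open>t\<close> has no fixed point on \<open>H \<inter> S\<close>, so \<open>b \<mapsto> b\<inverse> b\<^sup>t\<close> is injective, hence onto.\<close>
lemma conjugate_t_eq_inv:
  assumes a: "a \<in> H" "a \<in> S"
  shows "conjugate t a = inv a"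
proof -
  define \<phi> where "\<phi> b = inv b \<otimes> conjugate t b" for b
  have "\<phi> ` (H \<inter> S) \<subseteq> H \<inter> S"
    unfolding \<phi>_def using subgroup_H t_in_H
    by (auto simp: subgroup.m_closed subgroup.m_inv_closed conjugate_in_subgroup H_carrier
        mult_in_S_iff inv_in_S_iff conjugate_in_S_iff)
  moreover have "inj_on \<phi> (H \<inter> S)"
  proof (rule inj_onI)
    fix b c assume b: "b \<in> H \<inter> S" and c: "c \<in> H \<inter> S" and eq: "\<phi> b = \<phi> c"
    have bc: "b \<in> carrier G" "c \<in> carrier G" using b c H_carrier by auto
    have "c \<otimes> inv b \<otimes> conjugate t b = conjugate t c"
      using eq bc unfolding \<phi>_def by (simp add: m_assoc) (simp add: m_assoc[symmetric])
    then have "conjugate t (c \<otimes> inv b) = c \<otimes> inv b"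
      using bc by (metis conjugate_inv conjugate_mult conjugate_closed inv_closed inv_solve_right
          m_closed t_carrier)
    moreover have "c \<otimes> inv b \<in> H" "c \<otimes> inv b \<in> S"
      using b c subgroup_H S(1) by (auto simp: subgroup.m_closed subgroup.m_inv_closed)
    ultimately have "c \<otimes> inv b = \<one>" using fixed_eq_one by blast
    then show "b = c" using bc by (metis inv_equality inv_inv inv_closed)
  qed
  moreover have "finite (H \<inter> S)"
    using S_subset finite_carrier by (meson finite_Int finite_subset)
  ultimately have "\<phi> ` (H \<inter> S) = H \<inter> S" by (rule endo_inj_surj[rotated])
  then obtain b where b: "b \<in> H \<inter> S" "a = inv b \<otimes> conjugate t b"
    using a unfolding \<phi>_def by blast
  then show ?thesis
    by (simp add: H_carrier conjugate_mult conjugate_inv conjugate_t_conjugate_t inv_mult_group)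
qed

text \<open>An involution inverted by \<open>t\<close> would be fixed by \<open>t\<close>, against
  \<open>fixed_eq_one\<close>.\<close>

lemma square_ne_one:
  assumes "a \<in> H" "a \<in> S" "a \<noteq> \<one>"
  shows "a \<otimes> a \<noteq> \<one>"
proof
  assume "a \<otimes> a = \<one>"
  then have "inv a = a" using assms H_carrier by (simp add: inv_equality)
  then show False using conjugate_t_eq_inv fixed_eq_one assms by metis
qed

text \<open>On \<open>H \<inter> S\<close> inversion agrees with conjugation by \<open>t\<close>, so
  it is multiplicative, which forces commutativity.\<close>

lemma commute_H_S:
  assumes "a \<in> H" "a \<in> S" "b \<in> H" "b \<in> S"
  shows "a \<otimes> b = b \<otimes> a"
proof -
  have ab: "a \<otimes> b \<in> H" "a \<otimes> b \<in> S"
    using assms subgroup_H S(1) by (auto simp: subgroup.m_closed)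
  have "inv (a \<otimes> b) = conjugate t (a \<otimes> b)"
    using conjugate_t_eq_inv ab by simp
  also have "\<dots> = inv a \<otimes> inv b"
    using assms by (simp add: conjugate_mult H_carrier conjugate_t_eq_inv)
  also have "\<dots> = inv (b \<otimes> a)"
    using assms by (simp add: inv_mult_group H_carrier)
  finally show ?thesis
    using assms H_carrier by (metis inv_inv m_closed)
qed

text \<open>Uniqueness of \<open>z\<close> is exploited through conjugates. Elements of
  \<open>H \<inter> S\<close> fix \<open>a\<close> and \<open>t\<close> inverts it, so in each case
  the conjugate of \<open>z\<close> still commutes with \<open>a\<close> and equals
  \<open>z\<close>. If \<open>z\<close> lay in \<open>H\<close>, commuting with \<open>t\<close>
  would make it equal to \<open>t\<close>, and \<open>t\<close> would then fix
  \<open>a\<close>.\<close>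

lemma involution_commutes_H:
  assumes a: "a \<in> H" "a \<in> S" "a \<noteq> \<one>" and z: "involution z" "z \<otimes> a = a \<otimes> z"
  shows "H \<subseteq> centralizer z" "z \<notin> H"
proof -
  have zc: "z \<in> carrier G" using z by (simp add: involution_def)
  have aa: "a \<otimes> a \<noteq> \<one>" using square_ne_one a by blast
  have ac: "a \<in> carrier G" using a H_carrier by blast
  have S_part: "b \<in> centralizer z" if "b \<in> H" "b \<in> S" for b
  proof -
    have bc: "b \<in> carrier G" using that H_carrier by blast
    have "conjugate b a = a"
      using commute_H_S[of b a] that a ac bc by (simp add: conjugate_fixed_iff)
    then have "conjugate b z \<otimes> a = a \<otimes> conjugate b z"
      using conjugate_commute_iff[of b z a] z(2) bc zc ac by simp
    then have "conjugate b z = z"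
      using commuting_involution_unique[OF ac aa _ z(1) _ z(2)] involution_conjugate z(1) bc by blast
    then show ?thesis using bc zc by (simp add: centralizer_def conjugate_fixed_iff)
  qed
  have t_part: "t \<in> centralizer z"
  proof -
    have "conjugate t z \<otimes> inv a = inv a \<otimes> conjugate t z"
      using conjugate_commute_iff[of t z a] z(2) zc ac conjugate_t_eq_inv a by simp
    then have "inv a \<in> centralizer (conjugate t z)"
      using zc ac by (simp add: centralizer_def)
    then have "a \<in> centralizer (conjugate t z)"
      using centralizer_subgroup[of "conjugate t z"] zc ac
      by (metis conjugate_closed inv_inv subgroup.m_inv_closed t_carrier)
    then have "conjugate t z \<otimes> a = a \<otimes> conjugate t z"
      by (simp add: centralizer_def)
    then have "conjugate t z = z"
      using commuting_involution_unique[OF ac aa _ z(1) _ z(2)] involution_conjugate z(1) t_carrier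
      by blast
    then show ?thesis using zc by (simp add: centralizer_def conjugate_fixed_iff)
  qed
  show "H \<subseteq> centralizer z"
  proof
    fix h assume h: "h \<in> H"
    show "h \<in> centralizer z"
    proof (cases "h \<in> S")
      case False
      then have "t \<otimes> h \<in> centralizer z"
        using S_part[of "t \<otimes> h"] h H_carrier t subgroup_H t_in_H
        by (auto simp: subgroup.m_closed mult_in_S_iff)
      then have "t \<otimes> (t \<otimes> h) \<in> centralizer z"
        by (rule subgroup.m_closed[OF centralizer_subgroup[OF zc] t_part])
      then show ?thesis using h H_carrier t(1) by (simp add: m_assoc[symmetric] involution_def)
    qed (use S_part h in blast)
  qed
  show "z \<notin> H"
  proof
    assume "z \<in> H"
    moreover have "z \<in> centralizer t" using t_part zc by (simp add: centralizer_def)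
    ultimately have "z = t" using H z(1) by (auto simp: self_centralizing_def involution_def)
    then have "conjugate t a = a" using z(2) ac by (simp add: conjugate_fixed_iff)
    then show False using fixed_eq_one a by blast
  qed
qed

end

end

section \<open>Counting conjugates of torus elements\<close>

lemma two_thirds_bound:
  fixes m e i :: nat
  assumes "m * e \<le> i * (e + 1)" "2 \<le> e"
  shows "2 * m \<le> 3 * i"
proof -
  \<comment> \<open>From \<open>2 \<le> e\<close> the ratio \<open>e / (e + 1)\<close> is at least
    2/3. In its uses \<open>e\<close> counts the nontrivial elements in \<open>S\<close> of a
    subgroup of order \<open>2 * (e + 1)\<close>.\<close>
  have "(2 * m) * (e + 1) \<le> 3 * (m * e)"
    using assms(2) mult_le_mono2[of "2 * (e + 1)" "3 * e" m] by (simp add: algebra_simps)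
  also have "\<dots> \<le> (3 * i) * (e + 1)"
    using assms(1) by simp
  finally show ?thesis by (simp only: mult_le_cancel2)
qed

context outer_involution
begin

text \<open>The involution attached to an element of nontrivial square moves along with it under
  conjugation. This controls which \<open>x\<close> return a set to itself and keeps different
  families of conjugates apart.\<close>

lemma conjugate_unique_commuting:
  assumes x: "x \<in> carrier G" and b: "b \<in> carrier G" "b \<otimes> b \<noteq> \<one>"
    and z: "involution z" "z \<otimes> b = b \<otimes> z"
    and w: "involution w" "w \<otimes> conjugate x b = conjugate x b \<otimes> w"
  shows "w = conjugate x z"
proof -
  have zc: "z \<in> carrier G" using z by (simp add: involution_def)
  have "conjugate x z \<otimes> conjugate x b = conjugate x b \<otimes> conjugate x z"
    using conjugate_commute_iff[OF x zc b(1)] z(2) by simp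
  moreover have "conjugate x b \<otimes> conjugate x b \<noteq> \<one>"
    using b conjugate_square_eq_one_iff x by simp
  ultimately show ?thesis
    using commuting_involution_unique[of "conjugate x b" w "conjugate x z"] w
      involution_conjugate[OF z(1) x] x b(1) by simp
qed

text \<open>The set to be counted consists of the identity, \<open>E\<close>, and the set
  \<open>R\<close> of involutions other than \<open>z\<close>. Translation by one element of
  \<open>R\<close> embeds \<open>R\<close> into \<open>insert \<one> E\<close>, so there are at most
  \<open>2 * card E + 2\<close> elements; when \<open>R\<close> is nonempty, \<open>E\<close> has at
  least two elements. The bound makes the conjugates of \<open>E\<close> fill at least a third of
  \<open>K \<inter> S\<close>.\<close>

lemma card_centralizer_inner_involution:
  assumes K: "subgroup K G" "t \<in> K"
    and z: "involution z" "z \<in> K" "z \<in> S" "z \<otimes> t = t \<otimes> z"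
  defines "E \<equiv> insert z {g \<in> K \<inter> S. g \<otimes> z = z \<otimes> g \<and> g \<otimes> g \<noteq> \<one>}"
  shows "card (K \<inter> centralizer z \<inter> S) \<le> 3 * card E"
proof -
  have Kc: "x \<in> carrier G" if "x \<in> K" for x using subgroup.mem_carrier[OF K(1) that] .
  have Km: "x \<otimes> y \<in> K" if "x \<in> K" "y \<in> K" for x y using subgroup.m_closed[OF K(1) that] .
  have zc: "z \<in> carrier G" using z by (simp add: involution_def)
  define N where "N = K \<inter> centralizer z \<inter> S"
  define R where "R = {g \<in> N. involution g \<and> g \<noteq> z}"
  have fin: "finite N" "finite E"
    unfolding N_def E_def using S_subset finite_carrier by (auto intro: finite_subset[of _ S] finite_subset)
  have E_N: "E \<subseteq> N"
    using z Kc by (auto simp: E_def N_def centralizer_def)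
  have oneE: "\<one> \<notin> E" using z by (auto simp: E_def involution_def)
  have NR: "N \<subseteq> insert \<one> (E \<union> R)"
    using Kc by (auto simp: N_def R_def E_def centralizer_def involution_def)
  have Nm: "x \<otimes> y \<in> N" if "x \<in> N" "y \<in> N" for x y
    using that subgroup.m_closed[OF K(1)] subgroup.m_closed[OF centralizer_subgroup[OF zc]]
      subgroup.m_closed[OF S(1)] unfolding N_def by blast
  show ?thesis
  proof (cases "R = {}")
    case True
    then have "card N \<le> card (insert \<one> E)"
      using NR fin by (intro card_mono) auto
    also have "\<dots> \<le> 3 * card E"
    proof -
      have "0 < card E" using fin by (auto simp: card_gt_0_iff E_def)
      then show ?thesis using fin oneE by simp
    qed
    finally show ?thesis by (simp add: N_def)
  next
    case False
    then obtain g where g: "g \<in> R" by blast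
    have gN: "g \<in> N" "involution g" "g \<noteq> z" "g \<in> K" "g \<in> S" "g \<in> carrier G" "g \<otimes> z = z \<otimes> g"
      using g Kc by (auto simp: R_def N_def centralizer_def)
    \<comment> \<open>If \<open>g \<otimes> h\<close> has trivial square, the involutions
      \<open>g\<close> and \<open>h\<close> commute, so by \<open>involution_rank\<close> the
      product is \<open>z\<close> unless \<open>g = h\<close>.\<close>
    have "(\<lambda>h. g \<otimes> h) ` R \<subseteq> insert \<one> E"
    proof
      fix u assume "u \<in> (\<lambda>h. g \<otimes> h) ` R"
      then obtain h where h: "h \<in> R" "u = g \<otimes> h" by blast
      have hN: "h \<in> N" "involution h" "h \<noteq> z" "h \<in> carrier G" "h \<otimes> z = z \<otimes> h"
        using h Kc by (auto simp: R_def N_def centralizer_def)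
      have uN: "u \<in> N" using h(2) Nm gN(1) hN(1) by simp
      show "u \<in> insert \<one> E"
      proof (cases "u \<otimes> u = \<one>")
        case False
        then show ?thesis using uN by (auto simp: E_def N_def centralizer_def)
      next
        case True
        have "g \<otimes> h = h \<otimes> g"
        proof -
          have "inv (g \<otimes> h) = g \<otimes> h"
            using True h(2) gN hN by (intro inv_equality) auto
          then show ?thesis
            using gN hN by (simp add: inv_mult_group involution_inv)
        qed
        then have "u = z" if "g \<noteq> h"
          using involution_rank[OF gN(2) hN(2) z(1) _ gN(7) hN(5) that gN(3) hN(3)] h(2) by simp
        moreover have "u = \<one>" if "g = h"
          using that h(2) gN(2) by (simp add: involution_def)
        ultimately show ?thesis by (auto simp: E_def)
      qed
    qed
    moreover have "inj_on (\<lambda>h. g \<otimes> h) R"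
      using gN Kc by (intro inj_onI) (metis (no_types, lifting) Int_iff N_def R_def Units_eq
          Units_l_cancel mem_Collect_eq)
    ultimately have cR: "card R \<le> card (insert \<one> E)"
      using fin card_inj_on_le[of _ R "insert \<one> E"] by simp
    \<comment> \<open>\<open>t g\<close> lies outside \<open>S\<close>, so it has order neither 2 (rank) nor 4, and its square enlarges \<open>E\<close>.\<close>
    define s where "s = t \<otimes> g"
    have sc: "s \<in> carrier G" "s \<notin> S" "s \<in> K"
      using gN t mult_in_S_iff[of t g] K Km by (auto simp: s_def)
    have sz: "s \<in> centralizer z"
      unfolding s_def by (rule subgroup.m_closed[OF centralizer_subgroup[OF zc]])
        (use gN z in \<open>auto simp: centralizer_def\<close>)
    have s2: "s \<otimes> s \<noteq> \<one>"
    proof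
      assume "s \<otimes> s = \<one>"
      then have "inv (t \<otimes> g) = t \<otimes> g"
        unfolding s_def using gN by (intro inv_equality) auto
      then have "t \<otimes> g = g \<otimes> t"
        using gN t by (simp add: inv_mult_group involution_inv)
      moreover have "t \<noteq> g" "t \<noteq> z" using t gN z by auto
      ultimately have "t \<otimes> g = z"
        using involution_rank[OF t(1) gN(2) z(1)] z(4) gN by simp
      then show False using sc z by (simp add: s_def)
    qed
    have "s \<otimes> s \<in> E"
    proof -
      have "(s \<otimes> s) \<otimes> (s \<otimes> s) \<noteq> \<one>" using order_four s2 sc by blast
      moreover have "s \<otimes> s \<in> K \<inter> S" using sc Km mult_in_S_iff by simp
      moreover have "s \<otimes> s \<in> centralizer z"
        by (rule subgroup.m_closed[OF centralizer_subgroup[OF zc] sz sz])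
      ultimately show ?thesis by (auto simp: E_def centralizer_def)
    qed
    moreover have "s \<otimes> s \<noteq> z"
    proof
      assume "s \<otimes> s = z"
      then have "(s \<otimes> s) \<otimes> (s \<otimes> s) = \<one>" using z by (simp add: involution_def)
      then show False using order_four s2 sc by blast
    qed
    ultimately have "card {z, s \<otimes> s} \<le> card E"
      using fin by (intro card_mono) (auto simp: E_def)
    then have "2 \<le> card E" using \<open>s \<otimes> s \<noteq> z\<close> by simp
    moreover have "card N \<le> 1 + card E + card R"
    proof -
      have "card N \<le> card (insert \<one> (E \<union> R))"
        using NR fin by (intro card_mono) (auto simp: R_def)
      also have "\<dots> \<le> Suc (card (E \<union> R))" by (rule card_insert_le_m1) auto
      finally show ?thesis using card_Un_le[of E R] by simp
    qed
    moreover have "card (insert \<one> E) \<le> Suc (card E)" by (rule card_insert_le_m1) auto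
    ultimately show ?thesis using cR by (simp add: N_def)
  qed
qed

text \<open>The counting argument. If \<open>K \<inter> centralizer z\<close> were contained in
  \<open>H\<close>, the conjugates of the nontrivial elements of \<open>H \<inter> S\<close> would
  form a set \<open>I1\<close> of at least two thirds of \<open>m = card (K \<inter> S)\<close>
  elements. A second family \<open>I2\<close>, built from an involution inside \<open>K\<close>, is
  disjoint from \<open>I1\<close> and has at least \<open>m / 3\<close> elements, whereas only
  \<open>m - 1\<close> nontrivial elements are available.\<close>

lemma ex_commuting_outside:
  assumes H: "self_centralizing H" and a: "a \<in> H" "a \<in> S" "a \<noteq> \<one>"
    and z: "involution z" "z \<otimes> a = a \<otimes> z"
    and K: "subgroup K G" "H \<subseteq> K" and u: "u \<in> K" "u \<otimes> t = t \<otimes> u" "u \<noteq> \<one>" "u \<noteq> t"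
  shows "\<not> K \<inter> centralizer z \<subseteq> H"
proof
  assume KH: "K \<inter> centralizer z \<subseteq> H"
  have tH: "t \<in> H" and tK: "t \<in> K" using t_in_H[OF H] K by auto
  have zH: "H \<subseteq> centralizer z" "z \<notin> H"
    using involution_commutes_H[OF H a z] by auto
  have zc: "z \<in> carrier G" using z by (simp add: involution_def)
  have zK: "z \<notin> K" using KH zH zc by (auto simp: centralizer_def)
  have Kc: "x \<in> carrier G" if "x \<in> K" for x using subgroup.mem_carrier[OF K(1) that] .
  have Km: "x \<otimes> y \<in> K" if "x \<in> K" "y \<in> K" for x y using subgroup.m_closed[OF K(1) that] .
  have finK: "finite K" by (rule finite_subset[OF subgroup.subset[OF K(1)] finite_carrier])
  define m where "m = card (K \<inter> S)"
  have cK: "card K = 2 * m" unfolding m_def by (rule card_subgroup_outer[OF K(1) tK t(2)])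

  define E1 where "E1 = H \<inter> S - {\<one>}"
  define I1 where "I1 = case_prod conjugate ` (K \<times> E1)"
  have E1: "b \<in> H" "b \<in> S" "b \<in> K" "b \<in> carrier G" "b \<otimes> b \<noteq> \<one>" "z \<otimes> b = b \<otimes> z" if "b \<in> E1" for b
    using that square_ne_one[OF H, of b] zH K(2) Kc by (auto simp: E1_def centralizer_def)
  \<comment> \<open>An \<open>x\<close> that carries an element of \<open>E1\<close> into
    \<open>E1\<close> must fix their common involution \<open>z\<close>, so by assumption it lies in
    \<open>H\<close>.\<close>
  have "card K * card E1 \<le> card I1 * card H"
    unfolding I1_def
  proof (rule card_conjugates_ge[OF finite_carrier K(1)])
    fix x b assume x: "x \<in> K" and b: "b \<in> E1" "conjugate x b \<in> E1"
    have "z = conjugate x z"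
      using conjugate_unique_commuting[OF Kc[OF x] E1(4,5)[OF b(1)] z(1) E1(6)[OF b(1)] z(1)]
        E1(6)[OF b(2)] by simp
    then have "x \<in> centralizer z"
      using Kc[OF x] zc conjugate_fixed_iff[of x z] by (simp add: centralizer_def)
    then show "x \<in> H" using KH x by blast
  qed (use E1 K in auto)
  moreover have "card H = 2 * (card E1 + 1)"
  proof -
    have "card (H \<inter> S) = card E1 + 1"
      unfolding E1_def using card.remove[of "H \<inter> S" \<one>] finite_subset[OF K(2) finK]
        subgroup.one_closed[OF subgroup_H[OF H]] by simp
    then show ?thesis using card_subgroup_outer[OF subgroup_H[OF H] tH t(2)] by simp
  qed
  ultimately have "m * card E1 \<le> card I1 * (card E1 + 1)" by (simp add: cK)
  moreover have "2 \<le> card E1"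
  proof -
    have ac: "a \<in> carrier G" using a K Kc by blast
    have "inv a \<noteq> a" using square_ne_one[OF H a] ac by (metis r_inv)
    moreover have "{a, inv a} \<subseteq> E1"
      using a ac subgroup.m_inv_closed[OF subgroup_H[OF H] a(1)] inv_in_S_iff by (auto simp: E1_def)
    ultimately show ?thesis
      using card_mono[of E1 "{a, inv a}"] finK E1(3) by (auto simp: finite_subset[of E1 K] subset_iff)
  qed
  ultimately have I1: "2 * m \<le> 3 * card I1" by (rule two_thirds_bound)
  have I1_sub: "I1 \<subseteq> K \<inter> S - {\<one>}"
    using E1 conjugate_in_subgroup[OF K(1)] Kc conjugate_in_S_iff conjugate_eq_one_iff
    unfolding I1_def by (auto simp: E1_def)
  have I1_sq: "i \<otimes> i \<noteq> \<one>" if "i \<in> I1" for i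
    using that E1 Kc conjugate_square_eq_one_iff unfolding I1_def by auto
  \<comment> \<open>The involution attached to an element of \<open>I1\<close> is a
    \<open>K\<close>-conjugate of \<open>z\<close> and hence lies outside \<open>K\<close>. The
    elements of \<open>I2\<close> will commute with involutions of \<open>K\<close>, which makes the
    families disjoint.\<close>
  have I1_comm: "w \<notin> K" if iw: "i \<in> I1" "involution w" "w \<otimes> i = i \<otimes> w" for i w
  proof
    assume w: "w \<in> K"
    obtain x b where x: "x \<in> K" and b: "b \<in> E1" and i: "i = conjugate x b"
      using iw(1) unfolding I1_def by auto
    have "w = conjugate x z"
      using conjugate_unique_commuting[OF Kc[OF x] E1(4,5)[OF b] z(1) E1(6)[OF b] iw(2)]
        iw(3) i by simp
    then have "z = conjugate (inv x) w" using Kc[OF x] zc by simp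
    then show False
      using zK conjugate_in_subgroup[OF K(1) subgroup.m_inv_closed[OF K(1) x] w] by simp
  qed

  have contra: False
    if "I2 \<subseteq> K \<inter> S - {\<one>}" "I1 \<inter> I2 = {}" "m \<le> 3 * card I2" for I2
  proof -
    have "card (I1 \<union> I2) \<le> card (K \<inter> S - {\<one>})"
      using that I1_sub finK by (intro card_mono) auto
    also have "\<dots> = m - 1"
      unfolding m_def using subgroup.one_closed[OF K(1)] by simp
    finally have "card I1 + card I2 \<le> m - 1"
      using card_Un_disjoint[of I1 I2] that I1_sub finK by (metis finite_Diff finite_Int finite_subset)
    moreover have "0 < m"
      unfolding m_def using subgroup.one_closed[OF K(1)] finK by (auto simp: card_gt_0_iff)
    ultimately show False using I1 that by linarith
  qed

  \<comment> \<open>If \<open>K \<inter> S\<close> has an involution \<open>z1\<close> commuting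
    with \<open>t\<close>, the second family comes from the centralizer of \<open>z1\<close>.
    Otherwise the nontrivial elements of \<open>S\<close> in \<open>K\<close> that commute with
    \<open>t\<close> all have nontrivial square, and the two-thirds estimate applies to them as
    well.\<close>
  show False
  proof (cases "\<exists>z1\<in>K \<inter> S. involution z1 \<and> z1 \<otimes> t = t \<otimes> z1")
    case True
    then obtain z1 where z1: "z1 \<in> K" "z1 \<in> S" "involution z1" "z1 \<otimes> t = t \<otimes> z1" by blast
    have z1c: "z1 \<in> carrier G" using z1 Kc by blast
    define E where "E = insert z1 {g \<in> K \<inter> S. g \<otimes> z1 = z1 \<otimes> g \<and> g \<otimes> g \<noteq> \<one>}"
    define N where "N = K \<inter> centralizer z1"
    define I2 where "I2 = case_prod conjugate ` (K \<times> E)"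
    have sgN: "subgroup N G"
      unfolding N_def by (intro subgroups_Inter_pair K(1) centralizer_subgroup z1c)
    have tN: "t \<in> N" using tK z1 by (simp add: N_def centralizer_def)
    have E: "b \<in> K" "b \<in> S" "b \<noteq> \<one>" "b \<in> carrier G" "z1 \<otimes> b = b \<otimes> z1" if "b \<in> E" for b
      using that z1 Kc S(1) by (auto simp: E_def involution_def)
    have "card K * card E \<le> card I2 * card N"
      unfolding I2_def
    proof (rule card_conjugates_ge[OF finite_carrier K(1)])
      fix x b assume x: "x \<in> K" and b: "b \<in> E" "conjugate x b \<in> E"
      have sq: "conjugate x b \<otimes> conjugate x b = \<one> \<longleftrightarrow> b \<otimes> b = \<one>"
        using conjugate_square_eq_one_iff x Kc E(4)[OF b(1)] by simp
      \<comment> \<open>Each element of \<open>E\<close> determines \<open>z1\<close>: it is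
        \<open>z1\<close> itself, the only involution in \<open>E\<close>, or its square is
        nontrivial and \<open>z1\<close> is the only involution commuting with it.\<close>
      have "conjugate x z1 = z1"
      proof (cases "b = z1")
        case True
        then show ?thesis using sq b(2) z1(3) by (auto simp: E_def involution_def)
      next
        case False
        then have "b \<otimes> b \<noteq> \<one>" using b(1) by (auto simp: E_def)
        then show ?thesis
          using conjugate_unique_commuting[OF Kc[OF x] E(4)[OF b(1)] _ z1(3) E(5)[OF b(1)] z1(3)]
            E(5)[OF b(2)] by simp
      qed
      then show "x \<in> N"
        using x Kc z1c conjugate_fixed_iff[of x z1] by (simp add: N_def centralizer_def)
    qed (use E in \<open>auto simp: N_def\<close>)
    also have "\<dots> = card I2 * (2 * card (N \<inter> S))"
      using card_subgroup_outer[OF sgN tN t(2)] by simp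
    finally have "m * card E \<le> card I2 * card (N \<inter> S)" by (simp add: cK)
    also have "\<dots> \<le> card I2 * (3 * card E)"
      using card_centralizer_inner_involution[OF K(1) tK z1(3,1,2,4)]
      unfolding E_def N_def by (rule mult_le_mono2)
    finally have "m * card E \<le> (3 * card I2) * card E" by (simp add: mult_ac)
    moreover have "card E > 0"
      using finK E(1) finite_subset[of E K] by (auto simp: card_gt_0_iff E_def)
    ultimately have "m \<le> 3 * card I2" by simp
    moreover have "I2 \<subseteq> K \<inter> S - {\<one>}"
      using E conjugate_in_subgroup[OF K(1)] Kc conjugate_in_S_iff conjugate_eq_one_iff
      unfolding I2_def by auto
    moreover have "I1 \<inter> I2 = {}"
    proof -
      have "conjugate x b \<notin> I1" if x: "x \<in> K" and b: "b \<in> E" for x b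
      proof
        assume "conjugate x b \<in> I1"
        moreover have "conjugate x z1 \<otimes> conjugate x b = conjugate x b \<otimes> conjugate x z1"
          using conjugate_commute_iff[of x z1 b] x Kc z1c E(4,5)[OF b] by simp
        ultimately show False
          using I1_comm[of "conjugate x b" "conjugate x z1"] involution_conjugate[OF z1(3)] Kc[OF x]
            conjugate_in_subgroup[OF K(1) x z1(1)] by simp
      qed
      then show ?thesis unfolding I2_def by auto
    qed
    ultimately show False using contra by blast
  next
    case False
    define N where "N = K \<inter> centralizer t"
    define E where "E = N \<inter> S - {\<one>}"
    define I2 where "I2 = case_prod conjugate ` (K \<times> E)"
    have sgN: "subgroup N G"
      unfolding N_def by (intro subgroups_Inter_pair K(1) centralizer_subgroup t_carrier)
    have tN: "t \<in> N" using tK by (simp add: N_def centralizer_def)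
    have E: "b \<in> K" "b \<in> S" "b \<noteq> \<one>" "b \<in> carrier G" "t \<otimes> b = b \<otimes> t" "b \<otimes> b \<noteq> \<one>"
      if "b \<in> E" for b
      using that Kc False by (auto simp: E_def N_def centralizer_def involution_def)
    have "card K * card E \<le> card I2 * card N"
      unfolding I2_def
    proof (rule card_conjugates_ge[OF finite_carrier K(1)])
      fix x b assume x: "x \<in> K" and b: "b \<in> E" "conjugate x b \<in> E"
      have "conjugate x t = t"
        using conjugate_unique_commuting[OF Kc[OF x] E(4,6)[OF b(1)] t(1) E(5)[OF b(1)] t(1)]
          E(5)[OF b(2)] by simp
      then show "x \<in> N"
        using x Kc conjugate_fixed_iff[of x t] by (simp add: N_def centralizer_def)
    qed (use E in \<open>auto simp: N_def\<close>)
    moreover have "card N = 2 * (card E + 1)"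
    proof -
      have "card (N \<inter> S) = card E + 1"
        unfolding E_def using card.remove[of "N \<inter> S" \<one>] finK subgroup.one_closed[OF sgN]
        by (simp add: N_def)
      then show ?thesis using card_subgroup_outer[OF sgN tN t(2)] by simp
    qed
    ultimately have "m * card E \<le> card I2 * (card E + 1)" by (simp add: cK)
    moreover have "2 \<le> card E"
    proof -
      \<comment> \<open>The element \<open>b\<close> is chosen in \<open>S\<close>; by the case
        assumption it is not an involution, so \<open>b\<close> and its inverse are two elements of
        \<open>E\<close>.\<close>
      define b where "b = (if u \<in> S then u else t \<otimes> u)"
      have uc: "u \<in> carrier G" using u Kc by blast
      have uN: "u \<in> N" using u uc by (simp add: N_def centralizer_def)
      have "t \<otimes> u \<noteq> \<one>"
        using u(4) uc t(1) by (metis involution_inv inv_equality inv_inv t_carrier)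
      then have b: "b \<in> E"
        using u(3) uN tN subgroup.m_closed[OF sgN tN uN] mult_in_S_iff[of t u] uc t(2)
        by (auto simp: b_def E_def)
      have "inv b \<noteq> b" using E(4,6)[OF b] by (metis r_inv)
      moreover have "inv b \<in> E"
        using b E(4)[OF b] subgroup.m_inv_closed[OF sgN, of b] inv_in_S_iff by (auto simp: E_def)
      ultimately show ?thesis
        using card_mono[of E "{b, inv b}"] finK b by (auto simp: E_def N_def)
    qed
    ultimately have "2 * m \<le> 3 * card I2" by (rule two_thirds_bound)
    then have "m \<le> 3 * card I2" by simp
    moreover have "I2 \<subseteq> K \<inter> S - {\<one>}"
      using E conjugate_in_subgroup[OF K(1)] Kc conjugate_in_S_iff conjugate_eq_one_iff
      unfolding I2_def by auto
    moreover have "I1 \<inter> I2 = {}"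
    proof -
      have "conjugate x b \<notin> I1" if x: "x \<in> K" and b: "b \<in> E" for x b
      proof
        assume "conjugate x b \<in> I1"
        moreover have "conjugate x t \<otimes> conjugate x b = conjugate x b \<otimes> conjugate x t"
          using conjugate_commute_iff[of x t b] x Kc E(4,5)[OF b] by simp
        ultimately show False
          using I1_comm[of "conjugate x b" "conjugate x t"] involution_conjugate[OF t(1)] Kc[OF x]
            conjugate_in_subgroup[OF K(1) x tK] by simp
      qed
      then show ?thesis unfolding I2_def by auto
    qed
    ultimately show False using contra by blast
  qed
qed

end

section \<open>Contractibility above an outer involution and of the whole subgroup poset\<close>

context outer_involution
begin

lemma pair_subset:
  assumes "{\<one>, t} \<subset> K"
  shows "{\<one>, t} \<subseteq> K \<inter> centralizer t"
  using assms by (auto simp: centralizer_def)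

text \<open>An element of \<open>H\<close> outside \<open>{\<one>, t}\<close> is moved into
  \<open>S\<close> by multiplying it with \<open>t\<close> if necessary; \<open>t\<close> inverts
  the result, which therefore commutes with an involution.\<close>

lemma self_centralizing_commuting_involution:
  assumes H: "self_centralizing H" and "{\<one>, t} \<subset> H"
  obtains a z where "a \<in> H" "a \<in> S" "a \<noteq> \<one>" "involution z" "z \<otimes> a = a \<otimes> z"
proof -
  obtain h where h: "h \<in> H" "h \<noteq> \<one>" "h \<noteq> t" using assms(2) by blast
  note hc = H_carrier[OF H h(1)]
  define a where "a = (if h \<in> S then h else t \<otimes> h)"
  have "t \<otimes> h \<noteq> \<one>"
    using h hc t(1) by (metis involution_inv inv_equality inv_inv t_carrier)
  then have a: "a \<in> H" "a \<in> S" "a \<noteq> \<one>"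
    using h hc t(2) mult_in_S_iff[of t h] subgroup.m_closed[OF subgroup_H[OF H] t_in_H[OF H] h(1)]
    by (auto simp: a_def)
  then obtain z where "involution z" "z \<otimes> a = a \<otimes> z"
    using ex_commuting_involution[OF t, of a] H_carrier[OF H] square_ne_one[OF H]
      conjugate_t_eq_inv[OF H] by blast
  then show ?thesis using that a by blast
qed

text \<open>This lets intersection with \<open>centralizer z\<close> contract the part above
  \<open>H\<close>. If \<open>K\<close> is again self-centralizing, \<open>z\<close> centralizes all
  of \<open>K\<close>, since \<open>a\<close> lies in \<open>K\<close> too. Otherwise
  \<open>K\<close> has a further element commuting with \<open>t\<close>, and the counting argument
  applies.\<close>

lemma subgroup_above_self_centralizing:
  assumes H: "self_centralizing H" and a: "a \<in> H" "a \<in> S" "a \<noteq> \<one>"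
    and z: "involution z" "z \<otimes> a = a \<otimes> z" and K: "subgroup K G" "H \<subset> K"
  shows "H \<subset> K \<inter> centralizer z"
proof -
  have HC: "H \<subseteq> centralizer z" using involution_commutes_H(1)[OF H a z] .
  show ?thesis
  proof (cases "self_centralizing K")
    case True
    then have "K \<subseteq> centralizer z"
      using involution_commutes_H(1)[OF True _ a(2,3) z] a(1) K(2) by blast
    then show ?thesis using K(2) by blast
  next
    case False
    have "t \<in> K" "\<one> \<in> K" using t_in_H[OF H] K subgroup.one_closed[OF K(1)] by auto
    then have "\<one> \<in> K \<inter> centralizer t" "t \<in> K \<inter> centralizer t"
      by (auto simp: centralizer_def)
    then obtain u where "u \<in> K" "u \<in> centralizer t" "u \<noteq> \<one>" "u \<noteq> t"
      using False K(1) unfolding self_centralizing_def by blast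
    then have "\<not> K \<inter> centralizer z \<subseteq> H"
      using ex_commuting_outside[OF H a z K(1) psubset_imp_subset[OF K(2)], of u]
      by (simp add: centralizer_def)
    then show ?thesis using HC K(2) by blast
  qed
qed

end

lemma AR_above_outer_involution:
  fixes G :: "('b::finite, 'c) monoid_scheme" (structure)
  assumes "outer_involution G S t"
  shows "AR (chain_complex {K \<in> proper_nontrivial_subgroups G. {\<one>, t} \<subset> K})"
proof -
  interpret outer_involution G S t by fact
  define X where "X = {K \<in> proper_nontrivial_subgroups G. {\<one>, t} \<subset> K}"
  define Q where "Q = {K \<in> X. K \<inter> centralizer t \<noteq> {\<one>, t}}"
  have X_iff: "K \<in> X \<longleftrightarrow> subgroup K G \<and> {\<one>, t} \<subset> K \<and> K \<noteq> carrier G" for K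
    by (auto simp: X_def proper_nontrivial_subgroups_def)
  have centralizer_X: "K \<inter> centralizer z \<in> X"
    if "subgroup K G" "involution z" "{\<one>, t} \<subset> K \<inter> centralizer z" for K z
  proof -
    have zc: "z \<in> carrier G" using that(2) by (simp add: involution_def)
    have "subgroup (K \<inter> centralizer z) G"
      by (intro subgroups_Inter_pair centralizer_subgroup zc that(1))
    moreover have "K \<inter> centralizer z \<noteq> carrier G"
      using involution_not_central[OF that(2)] by (auto simp: centralizer_def)
    ultimately show ?thesis using that(3) by (simp add: X_iff)
  qed
  have centralizer_X': "centralizer z \<in> X" if "involution z" "{\<one>, t} \<subset> centralizer z" for z
    using centralizer_X[OF subgroup_self that(1)] that(2)
    by (simp add: Int_absorb1 centralizer_def)
  have "AR (chain_complex X)"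
  proof (rule AR_chain_complex_upset[of Q])
    show "Q \<subseteq> X" by (auto simp: Q_def)
    show "L \<in> Q" if "K \<in> Q" "L \<in> X" "K \<le> L" for K L
    proof -
      have "{\<one>, t} \<subset> K \<inter> centralizer t"
        using that(1) pair_subset[of K] by (auto simp: Q_def X_def)
      then have "L \<inter> centralizer t \<noteq> {\<one>, t}" using that(3) by blast
      then show ?thesis using that(2) by (simp add: Q_def)
    qed
    show "AR (chain_complex Q)"
    proof (rule AR_chain_complex_meet)
      have "{\<one>, t} \<subset> centralizer t"
        using centralizer_outer[OF t] by (auto simp: centralizer_def)
      then show "centralizer t \<in> Q"
        using centralizer_X'[OF t(1)] centralizer_outer[OF t] by (simp add: Q_def)
      show "inf K (centralizer t) \<in> Q" if K: "K \<in> Q" for K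
      proof -
        have "{\<one>, t} \<subset> K \<inter> centralizer t"
          using K pair_subset[of K] by (auto simp: Q_def X_def)
        moreover have "subgroup K G" using K by (simp add: Q_def X_iff)
        ultimately show ?thesis using centralizer_X[OF _ t(1)] K by (simp add: Q_def Int_assoc)
      qed
    qed
    show "AR (chain_complex {K \<in> X. H < K})" if HX: "H \<in> X - Q" for H
    proof -
      have H: "self_centralizing H" "{\<one>, t} \<subset> H"
        using HX X_iff[of H] unfolding self_centralizing_def Q_def by blast+
      obtain a z where a: "a \<in> H" "a \<in> S" "a \<noteq> \<one>" and z: "involution z" "z \<otimes> a = a \<otimes> z"
        using self_centralizing_commuting_involution[OF H] by metis
      \<comment> \<open>Since \<open>z\<close> centralizes \<open>H\<close> without lying in it,
        \<open>centralizer z\<close> is strictly above \<open>H\<close> and can serve as the center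
        of the contraction.\<close>
      have "z \<in> centralizer z" using z(1) by (simp add: involution_def centralizer_def)
      then have HC: "H \<subset> centralizer z" using involution_commutes_H[OF H(1) a z] by blast
      show ?thesis
      proof (rule AR_chain_complex_meet)
        show "centralizer z \<in> {K \<in> X. H < K}"
          using centralizer_X'[OF z(1) psubset_trans[OF H(2) HC]] HC by simp
        show "inf K (centralizer z) \<in> {K \<in> X. H < K}" if K: "K \<in> {K \<in> X. H < K}" for K
        proof -
          have sK: "subgroup K G" "H \<subset> K" using K by (simp_all add: X_iff)
          have HK: "H \<subset> K \<inter> centralizer z"
            using subgroup_above_self_centralizing[OF H(1) a z sK] .
          then show ?thesis
            using centralizer_X[OF sK(1) z(1) psubset_trans[OF H(2) HK]] by simp
        qed
      qed
    qed
  qed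
  then show ?thesis by (simp add: X_def)
qed

lemma AR_proper_nontrivial_subgroups:
  fixes G :: "('b::finite, 'c) monoid_scheme" (structure)
  assumes "pgl2_like G S"
  shows "AR (chain_complex (proper_nontrivial_subgroups G))"
proof -
  interpret pgl2_like G S by fact
  let ?P = "proper_nontrivial_subgroups G"
  let ?Q = "{H \<in> ?P. H \<inter> S \<noteq> {\<one>}}"
  have P_iff: "H \<in> ?P \<longleftrightarrow> subgroup H G \<and> H \<noteq> {\<one>} \<and> H \<noteq> carrier G" for H
    by (simp add: proper_nontrivial_subgroups_def)
  show ?thesis
  proof (rule AR_chain_complex_upset[of ?Q])
    show "L \<in> ?Q" if K: "K \<in> ?Q" "L \<in> ?P" "K \<le> L" for K L
    proof -
      have "\<one> \<in> K \<inter> S" using K(1) P_iff[of K] by (auto simp: subgroup.one_closed)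
      then show ?thesis using K by blast
    qed
    show "AR (chain_complex ?Q)"
    proof (rule AR_chain_complex_meet)
      show "S \<in> ?Q" using S by (simp add: P_iff)
      show "inf H S \<in> ?Q" if H: "H \<in> ?Q" for H
      proof -
        have "subgroup (H \<inter> S) G"
          using H P_iff by (intro subgroups_Inter_pair S(1)) blast
        moreover have "H \<inter> S \<noteq> carrier G" using S(3) S_subset by blast
        ultimately show ?thesis using H by (simp add: P_iff)
      qed
    qed
    show "AR (chain_complex {K \<in> ?P. H < K})" if H: "H \<in> ?P - ?Q" for H
    proof -
      have sH: "subgroup H G" "H \<inter> S = {\<one>}" "H \<noteq> {\<one>}" using H P_iff by blast+
      then obtain t where tH: "t \<in> H" "t \<noteq> \<one>"
        using subgroup.one_closed[OF sH(1)] by blast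
      have tS: "t \<notin> S" using tH sH by blast
      have Hc: "x \<in> carrier G" if "x \<in> H" for x using subgroup.mem_carrier[OF sH(1) that] .
      \<comment> \<open>Two elements of \<open>H\<close> outside \<open>S\<close> have their product
        in the trivial group \<open>H \<inter> S\<close>, so \<open>t\<close> is an involution and
        the only such element.\<close>
      have tx: "t \<otimes> x = \<one>" if "x \<in> H" "x \<notin> S" for x
      proof -
        have "t \<otimes> x \<in> H \<inter> S"
          using that tH tS Hc mult_in_S_iff[of t x] subgroup.m_closed[OF sH(1)] by simp
        then show ?thesis using sH(2) by blast
      qed
      have t: "involution t" using tx[of t] tH tS Hc by (simp add: involution_def)
      have "x = t" if "x \<in> H" "x \<notin> S" for x
        using tx[OF that] tx[OF tH(1) tS] Hc tH(1) that(1) by (metis Units_eq Units_l_cancel)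
      then have "H = {\<one>, t}"
        using sH(2) tH subgroup.one_closed[OF sH(1)] by blast
      moreover have "outer_involution G S t"
        by unfold_locales (use t tS in auto)
      ultimately show ?thesis
        using AR_above_outer_involution[of G S t] by simp
    qed
  qed blast
qed

section \<open>Finite fields with 1 modulo 8 elements\<close>

locale finite_field_1_mod_8 =
  fixes ty :: "'f::{field,finite} itself"
  assumes card_mod_8: "CARD('f) mod 8 = 1"
begin

text \<open>Euler's formula for the quadratic character, with values taken in the field
  itself.\<close>

definition quad_char :: "'f \<Rightarrow> 'f" where
  "quad_char x = x ^ ((CARD('f) - 1) div 2)"

lemma quad_char_one [simp]: "quad_char 1 = 1"
  by (simp add: quad_char_def)

lemma quad_char_mult: "quad_char (x * y) = quad_char x * quad_char y"
  by (simp add: quad_char_def power_mult_distrib)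

lemma card_ge_9: "9 \<le> CARD('f)"
proof -
  have "card {0, 1 :: 'f} \<le> CARD('f)" by (rule card_mono) auto
  then have "2 \<le> CARD('f)" by simp
  then show ?thesis using card_mod_8 by presburger
qed

text \<open>Multiplication by \<open>x\<close> permutes the nonzero elements, so comparing their
  products before and after gives the claim.\<close>

lemma power_card_minus_1:
  assumes "x \<noteq> (0::'f)"
  shows "x ^ (CARD('f) - 1) = 1"
proof -
  have "(\<Prod>y\<in>UNIV-{0}. x * y) = (\<Prod>y\<in>UNIV-{0}. y)"
    by (rule prod.reindex_bij_witness[of _ "\<lambda>y. y / x" "\<lambda>y. x * y"]) (use assms in auto)
  moreover have "(\<Prod>y\<in>UNIV-{0}. x * y) = x ^ (CARD('f) - 1) * (\<Prod>y\<in>UNIV-{0}. y)"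
    by (simp add: prod.distrib card_Diff_singleton)
  ultimately show ?thesis by simp
qed

lemma quad_char_square:
  assumes "y \<noteq> 0"
  shows "quad_char (y * y) = 1"
proof -
  have "2 * ((CARD('f) - 1) div 2) = CARD('f) - 1"
    using card_mod_8 by presburger
  then show ?thesis
    using power_card_minus_1[OF assms] unfolding quad_char_def
    by (simp only: power2_eq_square[symmetric] power_mult[symmetric])
qed

lemma quad_char_cases: "x \<noteq> 0 \<Longrightarrow> quad_char x = 1 \<or> quad_char x = -1"
  using quad_char_square[of x] unfolding quad_char_mult by (simp add: square_eq_1_iff)

text \<open>The polynomial X^h - 1 with \<open>h = (q - 1) / 2\<close> has at most \<open>h\<close>
  roots, fewer than the \<open>q - 1\<close> nonzero elements.\<close>

lemma ex_nonsquare: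
  obtains x where "x \<noteq> 0" "quad_char x \<noteq> 1"
proof -
  let ?h = "(CARD('f) - 1) div 2"
  let ?p = "[:-1:] + monom (1::'f) ?h"
  have h: "0 < ?h" "?h < CARD('f) - 1" using card_ge_9 by auto
  have deg: "degree ?p = ?h"
    using h by (subst degree_add_eq_right) (auto simp: degree_monom_eq)
  then have "?p \<noteq> 0" using h by force
  then have "card {x. poly ?p x = 0} \<le> ?h"
    using card_poly_roots_bound deg by metis
  moreover have "card (UNIV - {0::'f}) = CARD('f) - 1"
    by (simp add: card_Diff_singleton)
  ultimately have "\<not> UNIV - {0} \<subseteq> {x. poly ?p x = 0}"
    using h card_mono[of "{x. poly ?p x = 0}" "UNIV - {0}"] by auto
  then show ?thesis using that by (auto simp: poly_monom quad_char_def)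
qed

lemma ex_minus_one_char:
  obtains x where "x \<noteq> 0" "quad_char x = -1" "quad_char x \<noteq> 1"
  using ex_nonsquare quad_char_cases by metis

lemma two_ne_zero [simp]: "(2::'f) \<noteq> 0"
proof
  assume "(2::'f) = 0"
  then have "(-1::'f) = 1" by (simp add: eq_neg_iff_add_eq_0 minus_equation_iff)
  moreover obtain x where "quad_char x = -1" "quad_char x \<noteq> 1" using ex_minus_one_char .
  ultimately show False by simp
qed

text \<open>For \<open>x\<close> of character -1, the power with exponent \<open>(q - 1) / 8\<close>
  is a primitive eighth root of unity.\<close>

lemma ex_fourth_root_minus_one:
  obtains \<zeta> :: 'f where "\<zeta> ^ 4 = -1"
proof -
  obtain x where x: "quad_char x = -1" using ex_minus_one_char by metis
  obtain k where k: "CARD('f) = 8 * k + 1"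
    using card_mod_8 mult_div_mod_eq[of 8 "CARD('f)"] by metis
  have "(CARD('f) - 1) div 2 = (CARD('f) - 1) div 8 * 4"
    by (simp add: k)
  then have "(x ^ ((CARD('f) - 1) div 8)) ^ 4 = -1"
    using x by (simp add: quad_char_def power_mult)
  then show ?thesis using that by blast
qed

lemma ex_sqrt_minus_one:
  obtains i :: 'f where "i * i = -1"
proof -
  obtain \<zeta> :: 'f where "\<zeta> ^ 4 = -1" using ex_fourth_root_minus_one .
  then have "\<zeta>^2 * \<zeta>^2 = -1" by (simp flip: power_add)
  then show ?thesis using that by blast
qed

lemma ex_sqrt_two:
  obtains r :: 'f where "r * r = 2"
proof -
  obtain \<zeta> :: 'f where \<zeta>: "\<zeta> ^ 4 = -1" using ex_fourth_root_minus_one .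
  \<comment> \<open>As \<zeta>^4 = -1, this is the square of the sum of \<zeta> and its
    inverse.\<close>
  have "(\<zeta> - \<zeta>^3) * (\<zeta> - \<zeta>^3) = 2"
    using \<zeta> by algebra
  then show ?thesis using that by blast
qed

text \<open>A trace-free matrix with eigenvalue \<open>y\<close> has determinant
  \<open>- (y * y)\<close>; thus an involution with a nonzero eigenvalue in the field will lie in
  \<open>psl2\<close>.\<close>

lemma quad_char_minus_square:
  assumes "y \<noteq> 0"
  shows "quad_char (- (y * y)) = 1"
proof -
  obtain i :: 'f where i: "i * i = -1" using ex_sqrt_minus_one .
  then have "- (y * y) = (i * y) * (i * y)" by algebra
  moreover have "i \<noteq> 0" using i by auto
  ultimately show ?thesis using quad_char_square[of "i * y"] assms by simp
qed

end

section \<open>Matrix representatives\<close>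

text \<open>Explicit cosets of the scalars turn equations in the quotient into matrix equations up
  to a nonzero factor.\<close>

definition mat2_class :: "'f::field mat2 \<Rightarrow> 'f mat2 set" where
  "mat2_class A = (case A of (a,b,c,d) \<Rightarrow> {(k*a, k*b, k*c, k*d) | k. k \<noteq> 0})"

lemma mat2_det_mult: "mat2_det (mat2_mult A B) = mat2_det A * mat2_det B"
  by (cases A; cases B) (simp add: mat2_det_def mat2_mult_def algebra_simps)

lemma group_GL2: "group (GL2 :: ('f::field mat2) monoid)"
proof (rule groupI)
  fix A :: "'f mat2" assume A: "A \<in> carrier GL2"
  obtain a b c d where abcd: "A = (a,b,c,d)" by (cases A)
  define D where "D = a * d - b * c"
  have D: "D \<noteq> 0" using A by (simp add: abcd D_def GL2_def mat2_det_def)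
  let ?B = "(d / D, - b / D, - c / D, a / D)"
  have "d / D * (a / D) - b / D * (c / D) = 1 / D"
    using D by (simp add: D_def divide_simps)
  then have "?B \<in> carrier GL2" using D by (simp add: GL2_def mat2_det_def)
  moreover have "mult GL2 ?B A = one GL2"
    using D by (simp add: abcd GL2_def mat2_mult_def D_def divide_simps)
  ultimately show "\<exists>B\<in>carrier GL2. mult GL2 B A = one GL2" by blast
next
  fix A B :: "'f mat2" assume "A \<in> carrier GL2" "B \<in> carrier GL2"
  then show "mult GL2 A B \<in> carrier GL2" by (simp add: GL2_def mat2_det_mult)
qed (auto simp: GL2_def mat2_mult_def mat2_det_def algebra_simps)

lemma normal_scalars2: "normal scalars2 (GL2 :: ('f::field mat2) monoid)"
proof -
  interpret group "GL2 :: 'f mat2 monoid" by (rule group_GL2)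
  have inv_scalar: "inv\<^bsub>GL2\<^esub> (a,0,0,a) = (1/a,0,0,1/a)" if "a \<noteq> 0" for a :: 'f
    using that by (intro inv_equality) (auto simp: GL2_def mat2_mult_def mat2_det_def)
  have "subgroup scalars2 (GL2 :: 'f mat2 monoid)"
  proof (rule subgroupI)
    fix A B :: "'f mat2" assume "A \<in> scalars2" "B \<in> scalars2"
    then show "A \<otimes>\<^bsub>GL2\<^esub> B \<in> scalars2"
      by (auto simp: scalars2_def GL2_def mat2_mult_def)
  qed (auto simp: scalars2_def inv_scalar intro: exI[of _ 1], auto simp: GL2_def mat2_det_def)
  moreover have "A \<otimes>\<^bsub>GL2\<^esub> s \<otimes>\<^bsub>GL2\<^esub> inv\<^bsub>GL2\<^esub> A \<in> scalars2"
    if "A \<in> carrier GL2" "s \<in> scalars2" for A s :: "'f mat2"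
  proof -
    have sc: "s \<in> carrier GL2" using that(2) by (auto simp: scalars2_def GL2_def mat2_det_def)
    have "A \<otimes>\<^bsub>GL2\<^esub> s = s \<otimes>\<^bsub>GL2\<^esub> A"
      using that(2) by (cases A) (auto simp: scalars2_def GL2_def mat2_mult_def)
    then have "A \<otimes>\<^bsub>GL2\<^esub> s \<otimes>\<^bsub>GL2\<^esub> inv\<^bsub>GL2\<^esub> A = s"
      using that(1) sc by (simp add: m_assoc)
    then show ?thesis using that(2) by simp
  qed
  ultimately show ?thesis by (simp add: normal_inv_iff)
qed

lemma scalars2_rcoset: "scalars2 #>\<^bsub>GL2\<^esub> A = mat2_class A"
  by (cases A) (auto simp: r_coset_def scalars2_def GL2_def mat2_mult_def mat2_class_def)

lemma carrier_PGL2: "carrier PGL2 = mat2_class ` {A. mat2_det A \<noteq> 0}"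
proof -
  have "carrier GL2 = {A. mat2_det A \<noteq> 0}" by (simp add: GL2_def)
  then show ?thesis
    unfolding PGL2_def FactGroup_def RCOSETS_def partial_object.simps scalars2_rcoset by blast
qed

lemma one_PGL2: "\<one>\<^bsub>PGL2\<^esub> = mat2_class (1,0,0,1)"
  by (auto simp: PGL2_def FactGroup_def scalars2_def mat2_class_def)

lemma mult_PGL2:
  assumes "mat2_det A \<noteq> 0" "mat2_det B \<noteq> 0"
  shows "mat2_class A \<otimes>\<^bsub>PGL2\<^esub> mat2_class B = mat2_class (mat2_mult A B)"
  using normal.rcos_sum[OF normal_scalars2, of A B] assms
  by (simp add: PGL2_def FactGroup_def scalars2_rcoset) (simp add: GL2_def)

lemma group_PGL2: "group PGL2"
  unfolding PGL2_def by (rule normal.factorgroup_is_group[OF normal_scalars2])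

lemma mat2_class_eq_iff:
  "mat2_class (a,b,c,d) = mat2_class (e,f,g,h) \<longleftrightarrow>
     (\<exists>k. k \<noteq> 0 \<and> e = k * a \<and> f = k * b \<and> g = k * c \<and> h = k * d)" (is "?L \<longleftrightarrow> ?R")
proof
  have "(e,f,g,h) \<in> mat2_class (a,b,c,d) \<longleftrightarrow> ?R"
    by (simp only: mat2_class_def prod.case mem_Collect_eq prod.inject) blast
  moreover have "(e,f,g,h) \<in> mat2_class (e,f,g,h)"
    unfolding mat2_class_def by (auto intro: exI[of _ 1])
  moreover assume ?L
  ultimately show ?R by simp
next
  assume ?R
  then obtain k where k: "k \<noteq> 0" "e = k * a" "f = k * b" "g = k * c" "h = k * d" by blast
  have "(l * a, l * b, l * c, l * d) = ((l/k) * e, (l/k) * f, (l/k) * g, (l/k) * h)" for l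
    using k by simp
  moreover have "(l * e, l * f, l * g, l * h) = ((l*k) * a, (l*k) * b, (l*k) * c, (l*k) * d)" for l
    using k by simp
  ultimately show ?L
    unfolding mat2_class_def prod.case
    by (intro equalityI subsetI; clarify) (metis divide_eq_0_iff k(1) mult_eq_0_iff)+
qed

lemma PGL2_cases:
  assumes "x \<in> carrier PGL2"
  obtains a b c d where "x = mat2_class (a,b,c,d)" "a * d - b * c \<noteq> 0"
  using assms by (auto simp: carrier_PGL2 mat2_det_def)

lemma mat2_class_in_PGL2: "a * d - b * c \<noteq> 0 \<Longrightarrow> mat2_class (a,b,c,d) \<in> carrier PGL2"
  by (auto simp: carrier_PGL2 mat2_det_def intro!: imageI)

lemma mult_PGL2_class:
  assumes "a * d - b * c \<noteq> 0" "e * h - f * g \<noteq> 0"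
  shows "mat2_class (a,b,c,d) \<otimes>\<^bsub>PGL2\<^esub> mat2_class (e,f,g,h)
    = mat2_class (a*e + b*g, a*f + b*h, c*e + d*g, c*f + d*h)"
  using mult_PGL2[of "(a,b,c,d)" "(e,f,g,h)"] assms by (simp add: mat2_det_def mat2_mult_def)

lemma det_mult_ne_zero:
  fixes a b c d e f g h :: "'f::field"
  assumes "a * d - b * c \<noteq> 0" "e * h - f * g \<noteq> 0"
  shows "(a*e + b*g) * (c*f + d*h) - (a*f + b*h) * (c*e + d*g) \<noteq> 0"
proof -
  have "(a*e + b*g) * (c*f + d*h) - (a*f + b*h) * (c*e + d*g) = (a*d - b*c) * (e*h - f*g)"
    by (simp add: algebra_simps)
  then show ?thesis using assms by simp
qed

lemma mat2_class_eq_one_iff: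
  assumes "a * d - b * c \<noteq> 0"
  shows "mat2_class (a,b,c,d) = \<one>\<^bsub>PGL2\<^esub> \<longleftrightarrow> b = 0 \<and> c = 0 \<and> a = d"
proof
  assume "b = 0 \<and> c = 0 \<and> a = d"
  then show "mat2_class (a,b,c,d) = \<one>\<^bsub>PGL2\<^esub>"
    unfolding one_PGL2 mat2_class_eq_iff using assms by (intro exI[of _ "1/a"]) auto
next
  assume "mat2_class (a,b,c,d) = \<one>\<^bsub>PGL2\<^esub>"
  then obtain k where "k \<noteq> 0" "1 = k * a" "0 = k * b" "0 = k * c" "1 = k * d"
    unfolding one_PGL2 mat2_class_eq_iff by blast
  then show "b = 0 \<and> c = 0 \<and> a = d" by (metis mult_eq_0_iff mult_left_cancel)
qed

text \<open>By Cayley-Hamilton the square of a matrix is its trace times the matrix plus a scalar,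
  hence scalar only if the trace vanishes or the matrix is scalar.\<close>

lemma square_eq_one_iff:
  assumes "a * d - b * c \<noteq> 0"
  shows "mat2_class (a,b,c,d) \<otimes>\<^bsub>PGL2\<^esub> mat2_class (a,b,c,d) = \<one>\<^bsub>PGL2\<^esub>
    \<longleftrightarrow> a + d = 0 \<or> (b = 0 \<and> c = 0 \<and> a = d)"
proof -
  have "a*b + b*d = b * (a + d)" "c*a + d*c = c * (a + d)"
    "a*a + b*c = c*b + d*d \<longleftrightarrow> (a - d) * (a + d) = 0"
    by (auto simp: algebra_simps)
  then show ?thesis
    using assms det_mult_ne_zero[OF assms assms]
    by (simp add: mult_PGL2_class mat2_class_eq_one_iff) auto
qed

text \<open>The factor \<open>k\<close> cannot be dropped: anticommuting matrices, with
  \<open>k = -1\<close>, also commute in the quotient.\<close>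

lemma commuting_iff:
  assumes "a * d - b * c \<noteq> 0" "e * h - f * g \<noteq> 0"
  shows "mat2_class (a,b,c,d) \<otimes>\<^bsub>PGL2\<^esub> mat2_class (e,f,g,h)
      = mat2_class (e,f,g,h) \<otimes>\<^bsub>PGL2\<^esub> mat2_class (a,b,c,d) \<longleftrightarrow>
    (\<exists>k. k \<noteq> 0 \<and> e*a + f*c = k * (a*e + b*g) \<and> e*b + f*d = k * (a*f + b*h) \<and>
       g*a + h*c = k * (c*e + d*g) \<and> g*b + h*d = k * (c*f + d*h))"
  using assms by (simp add: mult_PGL2_class mat2_class_eq_iff)

lemma ne_one_square_imp:
  assumes "a * d - b * c \<noteq> 0" "mat2_class (a,b,c,d) \<otimes>\<^bsub>PGL2\<^esub> mat2_class (a,b,c,d) \<noteq> \<one>\<^bsub>PGL2\<^esub>"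
  shows "a + d \<noteq> 0" "\<not> (b = 0 \<and> c = 0 \<and> a = d)"
  using assms by (simp_all add: square_eq_one_iff)

lemma mat2_class_scale: "k \<noteq> 0 \<Longrightarrow> mat2_class (k * a, k * b, k * c, k * d) = mat2_class (a,b,c,d)"
  unfolding eq_commute[of _ "mat2_class (a,b,c,d)"] mat2_class_eq_iff by blast

section \<open>Involutions as trace-free matrices and their commutation\<close>

context finite_field_1_mod_8
begin

interpretation PGL2: group "PGL2 :: 'f mat2 set monoid"
  by (rule group_PGL2)

lemma involution_class:
  assumes "a * a + b * c \<noteq> (0::'f)"
  shows "PGL2.involution (mat2_class (a,b,c,-a))"
proof -
  have det: "a * (-a) - b * c \<noteq> 0"
  proof
    assume "a * (-a) - b * c = 0"
    then have "a * a + b * c = 0" by algebra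
    then show False using assms by simp
  qed
  have "a \<noteq> -a" if "b = 0"
  proof
    assume "a = - a"
    then have "2 * a = 0" by algebra
    then show False using assms that by simp
  qed
  then show ?thesis
    unfolding PGL2.involution_def using det
    by (auto simp: square_eq_one_iff mat2_class_eq_one_iff mat2_class_in_PGL2)
qed

lemma involution_cases:
  assumes "PGL2.involution x"
  obtains a b c :: 'f where "x = mat2_class (a,b,c,-a)" "a * (-a) - b * c \<noteq> 0"
proof -
  obtain a b c d where x: "x = mat2_class (a,b,c,d)" "a * d - b * c \<noteq> 0"
    using assms PGL2_cases unfolding PGL2.involution_def by metis
  have "a + d = 0"
    using assms unfolding PGL2.involution_def x(1)
    by (auto simp: square_eq_one_iff[OF x(2)] mat2_class_eq_one_iff[OF x(2)])
  then have "d = -a" by (simp add: eq_neg_iff_add_eq_0 add.commute)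
  then show ?thesis using that x by blast
qed

text \<open>The last three assumptions say that \<open>(u,v,w,-u)\<close> commutes with \<open>(a,b,c,d)\<close>.\<close>
lemma traceless_commuting_proportional:
  fixes a b c d u v w :: 'f
  assumes "\<not> (b = 0 \<and> c = 0 \<and> a = d)" and nz: "\<not> (u = 0 \<and> v = 0 \<and> w = 0)"
    and comm: "b * w = v * c" "(a - d) * v = 2 * u * b" "(a - d) * w = 2 * u * c"
  shows "mat2_class (u,v,w,-u) = mat2_class (a - d, 2 * b, 2 * c, - (a - d))"
proof -
  have "\<exists>\<mu>. u = \<mu> * (a - d) \<and> v = \<mu> * (2 * b) \<and> w = \<mu> * (2 * c)"
  proof (cases "a = d")
    case True
    then have u: "u = 0" using comm assms(1) by auto
    show ?thesis
    proof (cases "b = 0")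
      case False
      then show ?thesis using True u comm(1)
        by (intro exI[of _ "v / (2 * b)"]) (simp add: divide_simps mult_ac)
    next
      case b: True
      then have "c \<noteq> 0" using assms(1) True by auto
      then show ?thesis using True u comm(1) b
        by (intro exI[of _ "w / (2 * c)"]) (simp add: divide_simps mult_ac)
    qed
  next
    case False
    then show ?thesis using comm(2,3)
      by (intro exI[of _ "u / (a - d)"]) (simp add: divide_simps mult_ac)
  qed
  then obtain \<mu> where \<mu>: "u = \<mu> * (a - d)" "v = \<mu> * (2 * b)" "w = \<mu> * (2 * c)" by blast
  then have "\<mu> \<noteq> 0" using nz by auto
  then show ?thesis
    using mat2_class_scale[OF \<open>\<mu> \<noteq> 0\<close>, of "a - d" "2 * b" "2 * c" "- (a - d)"]
    unfolding \<mu> by (simp only: mult_minus_right)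
qed

text \<open>Conjugation by the involution multiplies the matrix by a scalar but preserves its
  nonzero trace, so the scalar is 1 and the matrices truly commute. The involution is then the
  trace-free part of the matrix, written without denominators as twice the matrix minus its
  trace.\<close>

lemma commuting_involution_class:
  fixes a b c d u v w :: 'f
  assumes A: "a * d - b * c \<noteq> 0" "a + d \<noteq> 0" "\<not> (b = 0 \<and> c = 0 \<and> a = d)"
    and Z: "u * (-u) - v * w \<noteq> 0"
    and comm: "mat2_class (u,v,w,-u) \<otimes>\<^bsub>PGL2\<^esub> mat2_class (a,b,c,d)
       = mat2_class (a,b,c,d) \<otimes>\<^bsub>PGL2\<^esub> mat2_class (u,v,w,-u)"
  shows "mat2_class (u,v,w,-u) = mat2_class (a - d, 2 * b, 2 * c, - (a - d))"
proof -
  obtain k where k: "k \<noteq> 0"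
    "a * u + b * w = k * (u * a + v * c)" "a * v + b * (-u) = k * (u * b + v * d)"
    "c * u + d * w = k * (w * a + (-u) * c)" "c * v + d * (-u) = k * (w * b + (-u) * d)"
    using comm unfolding commuting_iff[OF Z A(1)] by blast
  have "(k - 1) * ((a + d) * (u * (-u) - v * w)) = 0"
    using k(2-5) by algebra
  then have "k = 1" using A(2) Z by simp
  then show ?thesis
  proof (intro traceless_commuting_proportional A(3))
    show "b * w = v * c" using k(2) \<open>k = 1\<close> by algebra
    show "(a - d) * v = 2 * u * b" using k(3) \<open>k = 1\<close> by algebra
    show "(a - d) * w = 2 * u * c" using k(4) \<open>k = 1\<close> by algebra
  qed (use Z in auto)
qed

text \<open>The conclusion says that the product of the two matrices has trace 0. Both orders of
  multiplication give the same trace, so a nonzero trace would force \<open>k = 1\<close>, and truly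
  commuting trace-free matrices are proportional.\<close>

lemma distinct_commuting_involutions:
  fixes a b c u v w :: 'f
  assumes A: "a * (-a) - b * c \<noteq> 0" and Z: "u * (-u) - v * w \<noteq> 0"
    and comm: "mat2_class (u,v,w,-u) \<otimes>\<^bsub>PGL2\<^esub> mat2_class (a,b,c,-a)
       = mat2_class (a,b,c,-a) \<otimes>\<^bsub>PGL2\<^esub> mat2_class (u,v,w,-u)"
    and ne: "mat2_class (u,v,w,-u) \<noteq> mat2_class (a,b,c,-a)"
  shows "2 * a * u + b * w + c * v = 0"
proof (rule ccontr)
  assume tr: "2 * a * u + b * w + c * v \<noteq> 0"
  obtain k where k: "k \<noteq> 0"
    "a * u + b * w = k * (u * a + v * c)" "a * v + b * (-u) = k * (u * b + v * (-a))"
    "c * u + (-a) * w = k * (w * a + (-u) * c)" "c * v + (-a) * (-u) = k * (w * b + (-u) * (-a))"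
    using comm unfolding commuting_iff[OF Z A(1)] by blast
  have "(k - 1) * (2 * a * u + b * w + c * v) = 0"
    using k(2,5) by algebra
  then have "k = 1" using tr by simp
  have "2 * (b * w - v * c) = 0 \<and> (a - - a) * v = 2 * u * b \<and> (a - - a) * w = 2 * u * c"
    using k(2-5) \<open>k = 1\<close> by algebra
  then have "mat2_class (u,v,w,-u) = mat2_class (a - - a, 2 * b, 2 * c, - (a - - a))"
    using A Z by (intro traceless_commuting_proportional) (auto simp: eq_neg_iff_add_eq_0 mult_2[symmetric])
  also have "\<dots> = mat2_class (a,b,c,-a)"
    using mat2_class_scale[of 2 a b c "-a"] by simp
  finally show False using ne by simp
qed

text \<open>The three trace-free matrices are pairwise orthogonal for the trace form, hence
  anticommute. The product of the first two is trace-free and commutes with the third, which must be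
  proportional to it.\<close>

lemma involution_product:
  assumes x: "PGL2.involution x" and y: "PGL2.involution y" and z: "PGL2.involution (z :: 'f mat2 set)"
    and comm: "x \<otimes>\<^bsub>PGL2\<^esub> y = y \<otimes>\<^bsub>PGL2\<^esub> x" "x \<otimes>\<^bsub>PGL2\<^esub> z = z \<otimes>\<^bsub>PGL2\<^esub> x" "y \<otimes>\<^bsub>PGL2\<^esub> z = z \<otimes>\<^bsub>PGL2\<^esub> y"
    and ne: "x \<noteq> y" "x \<noteq> z" "y \<noteq> z"
  shows "x \<otimes>\<^bsub>PGL2\<^esub> y = z"
proof -
  obtain a b c where X: "x = mat2_class (a,b,c,-a)" "a * (-a) - b * c \<noteq> 0"
    using involution_cases[OF x] .
  obtain e f g where Y: "y = mat2_class (e,f,g,-e)" "e * (-e) - f * g \<noteq> 0"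
    using involution_cases[OF y] .
  obtain u v w where Z: "z = mat2_class (u,v,w,-u)" "u * (-u) - v * w \<noteq> 0"
    using involution_cases[OF z] .
  have xy: "2 * e * a + f * c + g * b = 0"
    using distinct_commuting_involutions[OF Y(2) X(2)] comm ne X Y by simp
  have xz: "2 * u * a + v * c + w * b = 0"
    using distinct_commuting_involutions[OF Z(2) X(2)] comm ne X Z by simp
  have yz: "2 * u * e + v * g + w * f = 0"
    using distinct_commuting_involutions[OF Z(2) Y(2)] comm ne Y Z by simp
  define A B C where "A = a * e + b * g" and "B = a * f + b * (-e)" and "C = c * e + (-a) * g"
  have D: "c * f + (-a) * (-e) = - A"
    unfolding A_def using xy by algebra
  have det: "A * (-A) - B * C \<noteq> 0"
    using det_mult_ne_zero[OF X(2) Y(2)] unfolding D A_def B_def C_def .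
  have prod: "x \<otimes>\<^bsub>PGL2\<^esub> y = mat2_class (A,B,C,-A)"
    unfolding X(1) Y(1) mult_PGL2_class[OF X(2) Y(2)] D by (simp add: A_def B_def C_def)
  have "B * w = v * C"
    unfolding B_def C_def using xz yz by algebra
  have "z = mat2_class (A - - A, 2 * B, 2 * C, - (A - - A))"
    unfolding Z(1)
  proof (rule traceless_commuting_proportional)
    show "B * w = v * C" by fact
    show "(A - - A) * v = 2 * u * B" unfolding A_def B_def using xy xz yz by algebra
    show "(A - - A) * w = 2 * u * C" unfolding A_def C_def using xy xz yz by algebra
  qed (use det Z(2) in \<open>auto simp: eq_neg_iff_add_eq_0 mult_2[symmetric]\<close>)
  also have "\<dots> = mat2_class (A,B,C,-A)"
    using mat2_class_scale[of 2 A B C "-A"] by simp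
  finally show ?thesis using prod by simp
qed

section \<open>The subgroup PSL_2 and the verification of the locale assumptions\<close>

definition psl2 :: "'f mat2 set set" where
  "psl2 = mat2_class ` {A. mat2_det A \<noteq> 0 \<and> quad_char (mat2_det A) = 1}"

text \<open>Scaling by \<open>k\<close> multiplies the determinant by the square
  \<open>k * k\<close>, so its character depends only on the class.\<close>

lemma mat2_class_in_psl2_iff:
  assumes "a * d - b * c \<noteq> 0"
  shows "mat2_class (a,b,c,d) \<in> psl2 \<longleftrightarrow> quad_char (a * d - b * c) = 1"
proof
  assume "mat2_class (a,b,c,d) \<in> psl2"
  then obtain e f g h where *: "mat2_class (e,f,g,h) = mat2_class (a,b,c,d)"
    "quad_char (e * h - f * g) = 1"
    by (auto simp: psl2_def mat2_det_def)
  then obtain k where "k \<noteq> 0" "a = k * e" "b = k * f" "c = k * g" "d = k * h"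
    unfolding mat2_class_eq_iff by blast
  then have "a * d - b * c = (k * k) * (e * h - f * g)" "k \<noteq> 0"
    by (auto simp: algebra_simps)
  then show "quad_char (a * d - b * c) = 1"
    using *(2) by (simp add: quad_char_mult[of "k * k"] quad_char_square)
next
  assume "quad_char (a * d - b * c) = 1"
  then show "mat2_class (a,b,c,d) \<in> psl2"
    using assms by (auto simp: psl2_def mat2_det_def intro!: imageI)
qed

lemma psl2_subset: "psl2 \<subseteq> carrier PGL2"
  by (auto simp: psl2_def carrier_PGL2)

lemma psl2_mult_iff:
  assumes "x \<in> carrier PGL2" "y \<in> carrier PGL2"
  shows "x \<otimes>\<^bsub>PGL2\<^esub> y \<in> psl2 \<longleftrightarrow> (x \<in> psl2 \<longleftrightarrow> y \<in> psl2)"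
proof -
  obtain a b c d where X: "x = mat2_class (a,b,c,d)" "a * d - b * c \<noteq> 0"
    using PGL2_cases[OF assms(1)] .
  obtain e f g h where Y: "y = mat2_class (e,f,g,h)" "e * h - f * g \<noteq> 0"
    using PGL2_cases[OF assms(2)] .
  have "(a * e + b * g) * (c * f + d * h) - (a * f + b * h) * (c * e + d * g)
      = (a * d - b * c) * (e * h - f * g)"
    by (simp add: algebra_simps)
  moreover have "(-1::'f) \<noteq> 1"
    using ex_minus_one_char by metis
  ultimately show ?thesis
    using quad_char_cases[OF X(2)] quad_char_cases[OF Y(2)]
      mat2_class_in_psl2_iff[OF det_mult_ne_zero[OF X(2) Y(2)]]
    unfolding X(1) Y(1) mult_PGL2_class[OF X(2) Y(2)] mat2_class_in_psl2_iff[OF X(2)]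
      mat2_class_in_psl2_iff[OF Y(2)] by (auto simp: quad_char_mult)
qed

lemma one_in_psl2: "\<one>\<^bsub>PGL2\<^esub> \<in> psl2"
  unfolding one_PGL2 by (simp add: mat2_class_in_psl2_iff)

lemma subgroup_psl2: "subgroup psl2 PGL2"
proof (rule PGL2.subgroupI)
  show "inv\<^bsub>PGL2\<^esub> x \<in> psl2" if "x \<in> psl2" for x
    using that psl2_subset psl2_mult_iff[of x "inv\<^bsub>PGL2\<^esub> x"] one_in_psl2 by auto
  show "x \<otimes>\<^bsub>PGL2\<^esub> y \<in> psl2" if "x \<in> psl2" "y \<in> psl2" for x y
    using that psl2_subset psl2_mult_iff[of x y] by auto
qed (use psl2_subset one_in_psl2 in auto)

lemma transvection_in_psl2: "mat2_class (1,1,0,1) \<in> psl2"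
  by (simp add: mat2_class_in_psl2_iff)

lemma psl2_ne_one: "psl2 \<noteq> {\<one>\<^bsub>PGL2\<^esub>}"
  using transvection_in_psl2 mat2_class_eq_one_iff[of 1 1 1 0] by auto

lemma psl2_ne_carrier: "psl2 \<noteq> carrier PGL2"
proof -
  obtain x where x: "x \<noteq> 0" "quad_char x \<noteq> 1" using ex_nonsquare .
  then have "mat2_class (x,0,0,1) \<in> carrier PGL2" "mat2_class (x,0,0,1) \<notin> psl2"
    by (simp_all add: mat2_class_in_PGL2 mat2_class_in_psl2_iff)
  then show ?thesis by blast
qed

text \<open>If \<open>t\<close> inverts \<open>a\<close>, it anticommutes with the trace-free part \<open>a\<^sub>0\<close> of \<open>a\<close>. Were \<open>a\<^sub>0\<close>
  nilpotent, \<open>t\<close> would preserve its kernel and so have an eigenvalue in the field, making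
  its determinant a square.\<close>
lemma outer_involution_inverting:
  assumes t: "PGL2.involution t" "t \<notin> psl2"
    and a: "a \<in> carrier PGL2" "a \<otimes>\<^bsub>PGL2\<^esub> a \<noteq> \<one>\<^bsub>PGL2\<^esub>" "PGL2.conjugate t a = inv\<^bsub>PGL2\<^esub> a"
  shows "\<exists>z. PGL2.involution z \<and> z \<otimes>\<^bsub>PGL2\<^esub> a = a \<otimes>\<^bsub>PGL2\<^esub> z"
proof -
  have tc: "t \<in> carrier PGL2" using t by (simp add: PGL2.involution_def)
  obtain r s u where T: "t = mat2_class (r,s,u,-r)" "r * (-r) - s * u \<noteq> 0"
    using involution_cases[OF t(1)] .
  obtain p q v w where A: "a = mat2_class (p,q,v,w)" "p * w - q * v \<noteq> 0"
    using PGL2_cases[OF a(1)] .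
  note A' = ne_one_square_imp[OF A(2) a(2)[unfolded A(1)]]
  have TA_ne: "t \<otimes>\<^bsub>PGL2\<^esub> a \<noteq> \<one>\<^bsub>PGL2\<^esub>"
  proof
    assume "t \<otimes>\<^bsub>PGL2\<^esub> a = \<one>\<^bsub>PGL2\<^esub>"
    then have "a = inv\<^bsub>PGL2\<^esub> t"
      using a(1) tc by (metis PGL2.inv_equality PGL2.inv_inv PGL2.inv_closed)
    then have "a = t" using PGL2.involution_inv[OF t(1)] by simp
    then show False using a(2) t(1) by (simp add: PGL2.involution_def)
  qed
  \<comment> \<open>Since \<open>t\<close> inverts \<open>a\<close>, the product of \<open>t\<close>
    and \<open>a\<close> is an involution; the vanishing of its trace expresses that
    \<open>t\<close> anticommutes with the trace-free part of \<open>a\<close>.\<close>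
  have "(t \<otimes>\<^bsub>PGL2\<^esub> a) \<otimes>\<^bsub>PGL2\<^esub> (t \<otimes>\<^bsub>PGL2\<^esub> a) = (t \<otimes>\<^bsub>PGL2\<^esub> a \<otimes>\<^bsub>PGL2\<^esub> t) \<otimes>\<^bsub>PGL2\<^esub> a"
    using a(1) tc by (simp add: PGL2.m_assoc)
  also have "\<dots> = inv\<^bsub>PGL2\<^esub> a \<otimes>\<^bsub>PGL2\<^esub> a"
    using a(3) PGL2.involution_inv[OF t(1)] by (simp add: PGL2.conjugate_def)
  also have "\<dots> = \<one>\<^bsub>PGL2\<^esub>" using a(1) by simp
  finally have "(r * p + s * v) + (u * q + (-r) * w) = 0"
    using TA_ne square_eq_one_iff[OF det_mult_ne_zero[OF T(2) A(2)]]
      mat2_class_eq_one_iff[OF det_mult_ne_zero[OF T(2) A(2)]]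
    unfolding T(1) A(1) mult_PGL2_class[OF T(2) A(2)] by blast
  then have tr: "r * (w - p) = s * v + u * q" by algebra
  have "(p - w) * (p - w) + (2 * q) * (2 * v) \<noteq> 0"
  proof
    assume nil: "(p - w) * (p - w) + (2 * q) * (2 * v) = 0"
    have "\<exists>y. r * r + s * u = y * y"
    proof (cases "q = 0")
      case False
      have div: "x = (m / n) * (m / n)" if "n * n * x = m * m" "n \<noteq> 0" for x m n :: 'f
        using that by (simp add: divide_simps mult_ac)
      \<comment> \<open>The kernel of the nilpotent matrix is spanned by
        \<open>(2 * q, w - p)\<close>, and the quotient obtained below is the eigenvalue of
        \<open>t\<close> on it, read off from the first coordinate.\<close>
      have "(2 * q) * (2 * q) * (r * r + s * u) = (2 * q * r + s * (w - p)) * (2 * q * r + s * (w - p))"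
        using nil tr by algebra
      then have "r * r + s * u = ((2 * q * r + s * (w - p)) / (2 * q)) * ((2 * q * r + s * (w - p)) / (2 * q))"
        by (rule div) (use False in simp)
      then show ?thesis by blast
    next
      case True
      then have "p = w" using nil by simp
      then have "s = 0" using A'(2) tr True by auto
      then show ?thesis by auto
    qed
    then obtain y where y: "r * r + s * u = y * y" by blast
    then have det: "r * (-r) - s * u = - (y * y)" by algebra
    then have "y \<noteq> 0" using T(2) by auto
    then have "t \<in> psl2"
      using quad_char_minus_square[of y] mat2_class_in_psl2_iff[OF T(2)] unfolding T(1) det by simp
    then show False using t(2) by simp
  qed
  note z = involution_class[OF this]
  have dz: "(p - w) * (- (p - w)) - (2 * q) * (2 * v) \<noteq> 0"
    using \<open>(p - w) * (p - w) + (2 * q) * (2 * v) \<noteq> 0\<close> by algebra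
  have "mat2_class (p - w, 2 * q, 2 * v, - (p - w)) \<otimes>\<^bsub>PGL2\<^esub> a
      = a \<otimes>\<^bsub>PGL2\<^esub> mat2_class (p - w, 2 * q, 2 * v, - (p - w))"
    unfolding A(1) commuting_iff[OF dz A(2)]
    by (intro exI[of _ 1] conjI) (simp_all add: algebra_simps)
  then show ?thesis using z by blast
qed

text \<open>The square of \<open>x\<close> is an involution and so has trace 0, which says that
  twice the determinant is the square of the trace. As 2 is a square, so is the determinant.\<close>

lemma order_four_in_psl2:
  assumes x: "x \<in> carrier PGL2" "x \<otimes>\<^bsub>PGL2\<^esub> x \<noteq> \<one>\<^bsub>PGL2\<^esub>"
    and "(x \<otimes>\<^bsub>PGL2\<^esub> x) \<otimes>\<^bsub>PGL2\<^esub> (x \<otimes>\<^bsub>PGL2\<^esub> x) = \<one>\<^bsub>PGL2\<^esub>"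
  shows "x \<in> psl2"
proof -
  obtain a b c d where X: "x = mat2_class (a,b,c,d)" "a * d - b * c \<noteq> 0"
    using PGL2_cases[OF x(1)] .
  have "(a * a + b * c) + (c * b + d * d) = 0"
    using assms(2,3) square_eq_one_iff[OF det_mult_ne_zero[OF X(2) X(2)]]
      mat2_class_eq_one_iff[OF det_mult_ne_zero[OF X(2) X(2)]]
    unfolding X(1) mult_PGL2_class[OF X(2) X(2)] by blast
  then have *: "2 * (a * d - b * c) = (a + d) * (a + d)" by algebra
  obtain h :: 'f where h: "h * h = 2" using ex_sqrt_two .
  then have "h \<noteq> 0" by (metis mult_zero_left two_ne_zero)
  then have "a * d - b * c = ((a + d) / h) * ((a + d) / h)"
    using * h by (simp add: divide_simps mult_ac)
  moreover have "a + d \<noteq> 0" using * X(2) by auto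
  ultimately show ?thesis
    using mat2_class_in_psl2_iff[OF X(2)] quad_char_square[of "(a + d) / h"] \<open>h \<noteq> 0\<close> X(1) by simp
qed

text \<open>An involution commuting with the transvection would be represented by the trace-free
  part of the transvection, which is singular.\<close>

lemma involution_not_central_PGL2:
  assumes "PGL2.involution (z :: 'f mat2 set)"
  shows "PGL2.centralizer z \<noteq> carrier PGL2"
proof
  assume "PGL2.centralizer z = carrier PGL2"
  moreover have "mat2_class (1,1,0,1) \<in> carrier (PGL2 :: 'f mat2 set monoid)"
    by (simp add: mat2_class_in_PGL2)
  ultimately have comm: "z \<otimes>\<^bsub>PGL2\<^esub> mat2_class (1,1,0,1) = mat2_class (1,1,0,1) \<otimes>\<^bsub>PGL2\<^esub> z"
    unfolding PGL2.centralizer_def by force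
  obtain u v w where Z: "z = mat2_class (u,v,w,-u)" "u * (-u) - v * w \<noteq> 0"
    using involution_cases[OF assms] .
  have "mat2_class (u,v,w,-u) = mat2_class (1 - 1, 2 * 1, 2 * 0, - (1 - 1))"
    using comm Z(2) unfolding Z(1) by (intro commuting_involution_class) auto
  then obtain k where "k \<noteq> 0" "0 = k * u" "0 = k * w"
    unfolding mat2_class_eq_iff by auto
  then show False using Z(2) by auto
qed

text \<open>The identity plus a trace-free matrix representing \<open>t\<close> commutes with
  \<open>t\<close> and has determinant 1 plus that of the representative. This is nonzero:
  determinant -1, minus a square, would put \<open>t\<close> in \<open>psl2\<close>.\<close>

lemma centralizer_outer_PGL2:
  assumes t: "PGL2.involution t" "t \<notin> psl2"
  shows "PGL2.centralizer t \<noteq> {\<one>\<^bsub>PGL2\<^esub>, t}"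
proof -
  obtain r s u where T: "t = mat2_class (r,s,u,-r)" "r * (-r) - s * u \<noteq> 0"
    using involution_cases[OF t(1)] .
  have "quad_char (r * (-r) - s * u) \<noteq> 1"
    using t(2) mat2_class_in_psl2_iff[OF T(2)] T(1) by simp
  then have "r * (-r) - s * u \<noteq> -1"
    using quad_char_minus_square[of 1] by auto
  then have D: "(1 + r) * (1 - r) - s * u \<noteq> 0" by algebra
  let ?x = "mat2_class (1 + r, s, u, 1 - r)"
  have "?x \<otimes>\<^bsub>PGL2\<^esub> t = t \<otimes>\<^bsub>PGL2\<^esub> ?x"
    unfolding T(1) commuting_iff[OF D T(2)]
    by (intro exI[of _ 1] conjI) (simp_all add: algebra_simps)
  then have "?x \<in> PGL2.centralizer t"
    using D by (simp add: PGL2.centralizer_def mat2_class_in_PGL2)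
  moreover have "?x \<noteq> \<one>\<^bsub>PGL2\<^esub>"
  proof
    assume "?x = \<one>\<^bsub>PGL2\<^esub>"
    then have *: "s = 0" "u = 0" "1 + r = 1 - r" unfolding mat2_class_eq_one_iff[OF D] by auto
    then have "2 * r = 0" by algebra
    then show False using * T(2) by simp
  qed
  moreover have "?x \<noteq> t"
  proof
    assume "?x = t"
    then obtain k where k: "r = k * (1 + r)" "- r = k * (1 - r)" "k \<noteq> 0"
      unfolding T(1) mat2_class_eq_iff by blast
    have "2 * k = 0" using k(1,2) by algebra
    then show False using k(3) by simp
  qed
  ultimately show ?thesis by blast
qed

lemma commuting_involution_unique_PGL2:
  assumes a: "(a :: 'f mat2 set) \<in> carrier PGL2" "a \<otimes>\<^bsub>PGL2\<^esub> a \<noteq> \<one>\<^bsub>PGL2\<^esub>"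
    and "PGL2.involution z" "z \<otimes>\<^bsub>PGL2\<^esub> a = a \<otimes>\<^bsub>PGL2\<^esub> z"
    and "PGL2.involution z'" "z' \<otimes>\<^bsub>PGL2\<^esub> a = a \<otimes>\<^bsub>PGL2\<^esub> z'"
  shows "z = z'"
proof -
  obtain p q v w where A: "a = mat2_class (p,q,v,w)" "p * w - q * v \<noteq> 0"
    using PGL2_cases[OF a(1)] .
  note A' = ne_one_square_imp[OF A(2) a(2)[unfolded A(1)]]
  have "y = mat2_class (p - w, 2 * q, 2 * v, - (p - w))"
    if y: "PGL2.involution y" "y \<otimes>\<^bsub>PGL2\<^esub> a = a \<otimes>\<^bsub>PGL2\<^esub> y" for y
  proof -
    obtain b c d where Y: "y = mat2_class (b,c,d,-b)" "b * (-b) - c * d \<noteq> 0"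
      using involution_cases[OF y(1)] .
    show ?thesis
      using commuting_involution_class[OF A(2) A' Y(2)] y(2) unfolding Y(1) A(1) by simp
  qed
  then show ?thesis using assms(3-6) by metis
qed

lemma pgl2_like_PGL2: "pgl2_like PGL2 psl2"
proof (intro pgl2_like.intro pgl2_like_axioms.intro group_PGL2)
  show "finite (carrier (PGL2 :: 'f mat2 set monoid))" by (rule finite)
  show "subgroup psl2 PGL2" by (rule subgroup_psl2)
  show "psl2 \<noteq> {\<one>\<^bsub>PGL2\<^esub>}" by (rule psl2_ne_one)
  show "psl2 \<noteq> carrier PGL2" by (rule psl2_ne_carrier)
  show "x \<otimes>\<^bsub>PGL2\<^esub> y \<in> psl2" if "x \<in> carrier PGL2 - psl2" "y \<in> carrier PGL2 - psl2" for x y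
    using that psl2_mult_iff[of x y] by simp
qed (rule outer_involution_inverting commuting_involution_unique_PGL2 involution_not_central_PGL2
    involution_product order_four_in_psl2 centralizer_outer_PGL2; assumption)+

end

section \<open>The subgroup complex\<close>

lemma image_iso_proper_nontrivial_subgroups:
  assumes "group G" "group H" and \<phi>: "\<phi> \<in> iso G H" and K: "K \<in> proper_nontrivial_subgroups G"
  shows "\<phi> ` K \<in> proper_nontrivial_subgroups H"
proof -
  interpret group_hom G H \<phi>
    using assms by (simp add: group_hom_def group_hom_axioms_def iso_def)
  have inj: "inj_on \<phi> (carrier G)" and im: "\<phi> ` carrier G = carrier H"
    using \<phi> by (auto simp: iso_def bij_betw_def)
  have K': "subgroup K G" "K \<noteq> {\<one>\<^bsub>G\<^esub>}" "K \<noteq> carrier G"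
    using K by (auto simp: proper_nontrivial_subgroups_def)
  have Kc: "K \<subseteq> carrier G" using subgroup.subset[OF K'(1)] .
  have "\<phi> ` K \<noteq> \<phi> ` {\<one>\<^bsub>G\<^esub>}"
    using inj_on_image_eq_iff[OF inj Kc, of "{\<one>\<^bsub>G\<^esub>}"] K'(2) by simp
  moreover have "\<phi> ` K \<noteq> \<phi> ` carrier G"
    using inj_on_image_eq_iff[OF inj Kc order_refl] K'(3) by simp
  ultimately show ?thesis
    using subgroup_img_is_subgroup[OF K'(1)] im by (simp add: proper_nontrivial_subgroups_def)
qed

lemma iso_bij_betw_proper_nontrivial_subgroups:
  assumes G: "group G" and H: "group H" and \<phi>: "\<phi> \<in> iso G H"
  shows "bij_betw ((`) \<phi>) (proper_nontrivial_subgroups G) (proper_nontrivial_subgroups H)"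
proof (rule bij_betw_imageI)
  have bij: "bij_betw \<phi> (carrier G) (carrier H)" using \<phi> by (simp add: iso_def)
  have sub: "K \<subseteq> carrier G" if "K \<in> proper_nontrivial_subgroups G" for K
    using that by (auto simp: proper_nontrivial_subgroups_def dest: subgroup.subset)
  show "inj_on ((`) \<phi>) (proper_nontrivial_subgroups G)"
    using inj_on_image_eq_iff[OF bij_betw_imp_inj_on[OF bij]] sub by (auto intro!: inj_onI)
  have "K \<in> (`) \<phi> ` proper_nontrivial_subgroups G" if K: "K \<in> proper_nontrivial_subgroups H" for K
  proof -
    let ?\<psi> = "inv_into (carrier G) \<phi>"
    have "?\<psi> ` K \<in> proper_nontrivial_subgroups G"
      using image_iso_proper_nontrivial_subgroups[OF H G group.iso_set_sym[OF G \<phi>] K] .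
    moreover have "K \<subseteq> carrier H"
      using K by (auto simp: proper_nontrivial_subgroups_def dest: subgroup.subset)
    then have "\<phi> ` (?\<psi> ` K) = K"
      using bij_betw_imp_surj_on[OF bij] by (metis image_inv_into_cancel)
    ultimately show ?thesis by (metis imageI)
  qed
  then show "(`) \<phi> ` proper_nontrivial_subgroups G = proper_nontrivial_subgroups H"
    using image_iso_proper_nontrivial_subgroups[OF G H \<phi>] by blast
qed

lemma odd_square_mod_8: "odd (m::nat) \<Longrightarrow> m * m mod 8 = 1"
proof -
  assume "odd m"
  then obtain j where m: "m = 2 * j + 1" by (rule oddE)
  have "even (j * (j + 1))" by simp
  then obtain i where "j * (j + 1) = 2 * i" by (rule evenE)
  then have "m * m = 8 * i + 1" unfolding m by (simp add: algebra_simps)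
  then show ?thesis by simp
qed

theorem theorem1p3:
  fixes G :: "('g, 'z) monoid_scheme" and p n :: nat
  assumes "prime p" and "p \<ge> 3" and "n \<ge> 1"
    and "CARD('f::{field,finite}) = p ^ (2 ^ n)"
    and "group G"
    and "G \<cong> (PGL2 :: ('f mat2 set) monoid)"
  shows "contractible_space
           (order_complex_topology (proper_nontrivial_subgroups G) (\<subseteq>))"
proof -
  let ?PGL = "PGL2 :: ('f mat2 set) monoid"
  \<comment> \<open>Since \<open>n\<close> is positive, the field order is the square of this odd
    number and hence 1 modulo 8.\<close>
  define m where "m = p ^ (2 ^ (n - 1))"
  have "odd m" using assms(1,2) prime_odd_nat[of p] by (simp add: m_def)
  moreover have "(2::nat) ^ n = 2 ^ (n - 1) + 2 ^ (n - 1)"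
    using assms(3) by (cases n) auto
  then have "CARD('f) = m * m"
    by (simp add: assms(4) m_def power_add)
  ultimately have "CARD('f) mod 8 = 1" by (simp add: odd_square_mod_8)
  then interpret finite_field_1_mod_8 "TYPE('f)" by unfold_locales
  have "AR (chain_complex (proper_nontrivial_subgroups ?PGL))"
    by (rule AR_proper_nontrivial_subgroups[OF pgl2_like_PGL2])
  then have "contractible_space (top_of_set (chain_complex (proper_nontrivial_subgroups ?PGL)))"
    by (simp add: AR_ANR)
  moreover obtain \<phi> where \<phi>: "\<phi> \<in> iso ?PGL G"
    using group.iso_sym[OF assms(5,6)] by (auto simp: is_iso_def)
  \<comment> \<open>The retract argument takes place over the finite type of \<open>PGL2\<close>;
    the isomorphism transports its conclusion to \<open>G\<close>, whose type is arbitrary.\<close>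
  have "top_of_set (chain_complex (proper_nontrivial_subgroups ?PGL)) homeomorphic_space
      order_complex_topology (proper_nontrivial_subgroups G) (\<subseteq>)"
  proof (rule order_complex_topology_homeomorphic)
    show "bij_betw ((`) \<phi>) (proper_nontrivial_subgroups ?PGL) (proper_nontrivial_subgroups G)"
      by (rule iso_bij_betw_proper_nontrivial_subgroups[OF group_PGL2 assms(5) \<phi>])
    show "\<phi> ` K \<subseteq> \<phi> ` L \<longleftrightarrow> K \<le> L"
      if "K \<in> proper_nontrivial_subgroups ?PGL" "L \<in> proper_nontrivial_subgroups ?PGL" for K L
    proof (rule inj_on_image_subset_iff)
      show "inj_on \<phi> (carrier ?PGL)" using \<phi> by (simp add: iso_def bij_betw_def)
    qed (use that in \<open>auto simp: proper_nontrivial_subgroups_def dest: subgroup.subset\<close>)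
  qed
  ultimately show ?thesis
    using homeomorphic_space_contractibility by blast
qed

end
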